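(* Let $K$ be an infinite field, let $n$ be a positive integer, and let $T=(T_{ijk})_{1\le i\le n,\,1\le j\le n,\,1\le k\le 2}$ be an $n\times n\times 2$-tensor of independent indeterminates. Put $X=(T_{ij1})$, $Y=(T_{ij2})$, and let $G=\mathrm{SL}(n,K)\times\mathrm{SL}(n,K)$ act on the polynomial ring $K[T]$ by $K$-algebra automorphisms such that $(P,Q)\in G$ sends $X$ to $P^\top XQ$ and $Y$ to $P^\top YQ$. Write $$\det(X+Y)=f_{n,0}+f_{n-1,1}+\cdots+f_{0,n},$$ where $f_{k,n-k}$ is the sum of the terms having degree $k$ in the indeterminates $T_{ij1}$ and degree $n-k$ in the indeterminates $T_{ij2}$. Then $f_{n,0},f_{n-1,1},\ldots,f_{0,n}$ is a sagbi basis of the invariant ring $K[T]^G$ (with respect to the monomial order on $K[T]$ specified in the context). In particular, $K[T]^G=K[f_{n,0},f_{n-1,1},\ldots,f_{0,n}]$, and $K[T]^G$ is isomorphic to the polynomial ring in $n+1$ variables over $K$.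
   Context: The monomial order on $K[T]$ is the degree lexicographic order with $T_{111}>T_{211}>\cdots>T_{n11}>T_{121}>\cdots>T_{n21}>\cdots>T_{nn1}>T_{112}>T_{212}>\cdots>T_{n12}>T_{122}>\cdots>T_{nn2}$ (that is, all $T_{ij1}$ are larger than all $T_{ij2}$, and for fixed $k$ the variables $T_{ijk}$ are ordered column by column, top to bottom within each column). $\mathrm{lm}(f)$ denotes the leading monomial of a nonzero polynomial $f$. A subset $F$ of a $K$-subalgebra $A$ of $K[T]$ is a sagbi basis of $A$ if the $K$-algebra generated by $\{\mathrm{lm}(f): f\in A, f\neq 0\}$ is generated by $\{\mathrm{lm}(f): f\in F\}$. *)

theory Defs
  imports "HOL-Library.Poly_Mapping" "Jordan_Normal_Form.Determinant"
begin

text \<open>Monomials are finitely supported exponent functions, and a polynomial is a finitely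
  supported function from monomials to coefficients, with the convolution product.
  The variables are taken from an arbitrary type; the set \<open>poly_ring V\<close> is the polynomial
  ring over the coefficient type in the variables from \<open>V\<close>.\<close>

type_synonym ('v, 'k) mpoly = "('v \<Rightarrow>\<^sub>0 nat) \<Rightarrow>\<^sub>0 'k"

definition poly_ring :: "'v set \<Rightarrow> ('v, 'k::field) mpoly set" where
  "poly_ring V = {p. \<forall>m \<in> Poly_Mapping.keys p. Poly_Mapping.keys m \<subseteq> V}"

definition Const :: "'k::field \<Rightarrow> ('v, 'k) mpoly" where
  "Const c = Poly_Mapping.single 0 c"

definition Var :: "'v \<Rightarrow> ('v, 'k::field) mpoly" where
  "Var v = Poly_Mapping.single (Poly_Mapping.single v 1) 1"

definition is_subalgebra :: "('v, 'k::field) mpoly set \<Rightarrow> bool" where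
  "is_subalgebra A \<longleftrightarrow> range Const \<subseteq> A \<and> (\<forall>p\<in>A. \<forall>q\<in>A. p + q \<in> A \<and> p * q \<in> A)"

definition algebra_gen :: "('v, 'k::field) mpoly set \<Rightarrow> ('v, 'k) mpoly set" where
  "algebra_gen S = is_subalgebra hull S"

text \<open>The value at \<open>p\<close> of the unique algebra endomorphism sending \<open>Var v\<close> to \<open>\<sigma> v\<close>
  for every variable \<open>v\<close>.\<close>

definition subst :: "('v \<Rightarrow> ('v, 'k) mpoly) \<Rightarrow> ('v, 'k::field) mpoly \<Rightarrow> ('v, 'k) mpoly" where
  "subst \<sigma> p = (\<Sum>m\<in>Poly_Mapping.keys p. Const (Poly_Mapping.lookup p m) *
     (\<Prod>v\<in>Poly_Mapping.keys m. \<sigma> v ^ Poly_Mapping.lookup m v))"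

definition algebra_iso ::
    "('v, 'k::field) mpoly set \<Rightarrow> ('w, 'k) mpoly set \<Rightarrow> (('v, 'k) mpoly \<Rightarrow> ('w, 'k) mpoly) \<Rightarrow> bool"
  where
  "algebra_iso A B \<phi> \<longleftrightarrow> bij_betw \<phi> A B \<and> (\<forall>c. \<phi> (Const c) = Const c) \<and>
     (\<forall>p\<in>A. \<forall>q\<in>A. \<phi> (p + q) = \<phi> p + \<phi> q \<and> \<phi> (p * q) = \<phi> p * \<phi> q)"

definition algebra_isomorphic ::
    "('v, 'k::field) mpoly set \<Rightarrow> ('w, 'k) mpoly set \<Rightarrow> bool" where
  "algebra_isomorphic A B \<longleftrightarrow> (\<exists>\<phi>. algebra_iso A B \<phi>)"

text \<open>All indices start at zero, as in the matrix library: the triple \<open>(i, j, k)\<close>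
  stands for the indeterminate \<open>T\<close> with indices \<open>i + 1\<close>, \<open>j + 1\<close>, \<open>k + 1\<close>.\<close>

type_synonym tvar = "nat \<times> nat \<times> nat"

definition tvars :: "nat \<Rightarrow> tvar set" where
  "tvars n = {..<n} \<times> {..<n} \<times> {..<2}"

text \<open>\<open>tvar_greater u v\<close> means \<open>u > v\<close>: first all variables of slice \<open>0\<close>, within a slice
  column by column, and within a column from top to bottom.\<close>

definition tvar_greater :: "tvar \<Rightarrow> tvar \<Rightarrow> bool" where
  "tvar_greater = (\<lambda>(i, j, k) (i', j', k').
     k < k' \<or> k = k' \<and> (j < j' \<or> j = j' \<and> i < i'))"

definition mdeg :: "('v \<Rightarrow>\<^sub>0 nat) \<Rightarrow> nat" where
  "mdeg m = (\<Sum>v\<in>Poly_Mapping.keys m. Poly_Mapping.lookup m v)"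

definition deglex_less :: "(tvar \<Rightarrow>\<^sub>0 nat) \<Rightarrow> (tvar \<Rightarrow>\<^sub>0 nat) \<Rightarrow> bool" where
  "deglex_less s t \<longleftrightarrow> mdeg s < mdeg t \<or> mdeg s = mdeg t \<and>
     (\<exists>v. Poly_Mapping.lookup s v < Poly_Mapping.lookup t v \<and>
       (\<forall>u. tvar_greater u v \<longrightarrow> Poly_Mapping.lookup s u = Poly_Mapping.lookup t u))"

definition lm :: "(tvar, 'k::field) mpoly \<Rightarrow> (tvar, 'k) mpoly" where
  "lm p = Poly_Mapping.single
     (THE m. m \<in> Poly_Mapping.keys p \<and> (\<forall>s\<in>Poly_Mapping.keys p. s \<noteq> m \<longrightarrow> deglex_less s m)) 1"

text \<open>Since \<open>lm\<close> is meaningful for nonzero polynomials only, a sagbi basis is required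
  to consist of nonzero elements.\<close>

definition sagbi_basis :: "(tvar, 'k::field) mpoly set \<Rightarrow> (tvar, 'k) mpoly set \<Rightarrow> bool" where
  "sagbi_basis A F \<longleftrightarrow> is_subalgebra A \<and> F \<subseteq> A - {0} \<and>
     algebra_gen {lm p | p. p \<in> A \<and> p \<noteq> 0} = algebra_gen (lm ` F)"

text \<open>\<open>slice n 0\<close> is the generic matrix \<open>X\<close> and \<open>slice n 1\<close> is the generic matrix \<open>Y\<close>.\<close>

definition slice :: "nat \<Rightarrow> nat \<Rightarrow> (tvar, 'k::field) mpoly mat" where
  "slice n k = mat n n (\<lambda>(i, j). Var (i, j, k))"

definition SL :: "nat \<Rightarrow> 'k::field mat set" where
  "SL n = {P \<in> carrier_mat n n. det P = 1}"

definition act :: "nat \<Rightarrow> 'k::field mat \<Rightarrow> 'k mat \<Rightarrow> (tvar, 'k) mpoly \<Rightarrow> (tvar, 'k) mpoly" where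
  "act n P Q = subst (\<lambda>(i, j, k).
     (map_mat Const (transpose_mat P) * slice n k * map_mat Const Q) $$ (i, j))"

definition invariant_ring :: "nat \<Rightarrow> (tvar, 'k::field) mpoly set" where
  "invariant_ring n = {p \<in> poly_ring (tvars n). \<forall>P\<in>SL n. \<forall>Q\<in>SL n. act n P Q p = p}"

definition slice_deg :: "nat \<Rightarrow> (tvar \<Rightarrow>\<^sub>0 nat) \<Rightarrow> nat" where
  "slice_deg k m = (\<Sum>v | v \<in> Poly_Mapping.keys m \<and> snd (snd v) = k. Poly_Mapping.lookup m v)"

definition bihom_part :: "nat \<Rightarrow> nat \<Rightarrow> (tvar, 'k::field) mpoly \<Rightarrow> (tvar, 'k) mpoly" where
  "bihom_part a b p = (\<Sum>m | m \<in> Poly_Mapping.keys p \<and> slice_deg 0 m = a \<and> slice_deg 1 m = b.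
     Poly_Mapping.single m (Poly_Mapping.lookup p m))"

definition f_inv :: "nat \<Rightarrow> nat \<Rightarrow> nat \<Rightarrow> (tvar, 'k::field) mpoly" where
  "f_inv n a b = bihom_part a b (det (slice n 0 + slice n 1))"

end

(* The pencils (X, Y) with X = diag(c_n, 1, ..., 1) and Y having first row (c_(n-1), ..., c_0),
   entries -1 on the subdiagonal and 0 elsewhere form a section of the action:
   det (t X + Y) = c_n t^n + ... + c_0, so the f's take the values c_0, ..., c_n there, and a generic
   pencil is carried to this shape by matrices P, Q with det P * det Q = 1 (bring X to
   diag(det X, 1, ..., 1), then use a Krylov basis).  An invariant p is unchanged by such a pair,
   although P and Q need not lie in SL, so it agrees with h(f_(0,n), ..., f_(n,0)) on a Zariski
   dense set, where h is the restriction of p to the section; as K is infinite, the two polynomials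
   are equal.  The leading monomial of f_(k,n-k) is x_11 ... x_kk y_(k+1,k+1) ... y_nn, and distinct
   products of these are distinct monomials, so the leading monomial of h(f) is a product of the
   leading monomials of the f's. *)

theory Submission
  imports Defs "HOL-Computational_Algebra.Polynomial"
begin

section \<open>Evaluation and substitution\<close>

text \<open>Since K need not be algebraically closed, the pair carrying a pencil to the section
  cannot be rescaled into SL(n) x SL(n): that would need n-th roots of determinants. Invariance
  under all pairs with det P * det Q = 1 is instead deduced from conjugation by diag(a, 1, ..., 1),
  where the value of an invariant is a Laurent polynomial in a that is known to be constant on n-th
  powers. Density is used one line at a time: a point is joined to a base point where the relevant
  determinant is 1, and along this line everything is a polynomial in one parameter. The generic
  condition has two parts with two base points: X = 1 for det X \<noteq> 0 and, with X = diag(det X,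
  1, ..., 1) fixed, the matrix with -1 on the subdiagonal, whose Krylov matrix is 1. The entries -1
  of the section absorb the cofactor signs, so the f's take the values c_k themselves, and
  restriction to the section is inverse to substituting the f's. This yields algebraic independence
  together with generation.\<close>

abbreviation lookup where "lookup \<equiv> Poly_Mapping.lookup"
abbreviation keys where "keys \<equiv> Poly_Mapping.keys"
abbreviation single where "single \<equiv> Poly_Mapping.single"

definition monom_val :: "('v \<Rightarrow> 'b) \<Rightarrow> ('v \<Rightarrow>\<^sub>0 nat) \<Rightarrow> 'b::comm_ring_1" where
  "monom_val \<sigma> m = (\<Prod>v\<in>keys m. \<sigma> v ^ lookup m v)"

text \<open>The coefficient map and the target ring are parameters, so that evaluation at a point,
  substitution of polynomials in other variables and restriction to a line (with
  \<open>[:c:]\<close> for coefficients) are instances of one map.\<close>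

definition insertion :: "('k::field \<Rightarrow> 'b) \<Rightarrow> ('v \<Rightarrow> 'b) \<Rightarrow> ('v, 'k) mpoly \<Rightarrow> 'b::comm_ring_1" where
  "insertion \<phi> \<sigma> p = (\<Sum>m\<in>keys p. \<phi> (lookup p m) * monom_val \<sigma> m)"

abbreviation eval :: "('v \<Rightarrow> 'k) \<Rightarrow> ('v, 'k::field) mpoly \<Rightarrow> 'k" where
  "eval \<equiv> insertion (\<lambda>c. c)"

lemma subst_eq_insertion: "subst \<sigma> p = insertion Const \<sigma> p"
  by (simp add: subst_def insertion_def monom_val_def)

lemma monom_val_superset:
  assumes "finite V" "keys m \<subseteq> V"
  shows "monom_val \<sigma> m = (\<Prod>v\<in>V. \<sigma> v ^ lookup m v)"
  unfolding monom_val_def using assms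
  by (intro prod.mono_neutral_left) (auto simp: in_keys_iff)

lemma monom_val_zero [simp]: "monom_val \<sigma> 0 = 1"
  by (simp add: monom_val_def)

lemma monom_val_add: "monom_val \<sigma> (m + m') = monom_val \<sigma> m * monom_val \<sigma> m'"
proof -
  let ?V = "keys m \<union> keys m'"
  have "monom_val \<sigma> (m + m') = (\<Prod>v\<in>?V. \<sigma> v ^ lookup (m + m') v)"
    by (rule monom_val_superset) (auto dest: set_mp[OF Poly_Mapping.keys_add])
  then show ?thesis
    by (simp add: lookup_add power_add prod.distrib monom_val_superset[of ?V m] monom_val_superset[of ?V m'])
qed

lemma monom_val_single: "monom_val \<sigma> (single v k) = \<sigma> v ^ k"
  by (cases "k = 0") (auto simp: monom_val_def)

lemma monom_val_cong: "(\<And>v. v \<in> keys m \<Longrightarrow> \<sigma> v = \<tau> v) \<Longrightarrow> monom_val \<sigma> m = monom_val \<tau> m"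
  by (auto simp: monom_val_def intro!: prod.cong)

lemma insertion_superset:
  assumes "finite M" "keys p \<subseteq> M" "\<phi> 0 = 0"
  shows "insertion \<phi> \<sigma> p = (\<Sum>m\<in>M. \<phi> (lookup p m) * monom_val \<sigma> m)"
  unfolding insertion_def using assms
  by (intro sum.mono_neutral_left) (auto simp: in_keys_iff)

lemma insertion_cong:
  assumes "p \<in> poly_ring V" "\<And>v. v \<in> V \<Longrightarrow> \<sigma> v = \<tau> v"
  shows "insertion \<phi> \<sigma> p = insertion \<phi> \<tau> p"
proof -
  have "monom_val \<sigma> m = monom_val \<tau> m" if "m \<in> keys p" for m
    using assms that by (intro monom_val_cong) (auto simp: poly_ring_def)
  then show ?thesis
    unfolding insertion_def by simp
qed

lemma sum_single_lookup: "(\<Sum>m\<in>keys p. single m (lookup p m)) = p"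
  by (rule poly_mapping_eqI) (simp add: lookup_sum lookup_single when_def in_keys_iff)

context
  fixes \<phi> :: "'k::field \<Rightarrow> 'b::comm_ring_1"
  assumes \<phi>: "comm_ring_hom \<phi>"
begin

interpretation comm_ring_hom \<phi> by (rule \<phi>)

lemma insertion_single: "insertion \<phi> \<sigma> (single m c) = \<phi> c * monom_val \<sigma> m"
  by (subst insertion_superset[of "{m}"]) auto

lemma insertion_Const: "insertion \<phi> \<sigma> (Const c) = \<phi> c"
  by (simp add: Const_def insertion_single)

lemma insertion_Var: "insertion \<phi> \<sigma> (Var v) = \<sigma> v"
  by (simp add: Var_def insertion_single monom_val_single)

lemma insertion_add: "insertion \<phi> \<sigma> (p + q) = insertion \<phi> \<sigma> p + insertion \<phi> \<sigma> q"
proof -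
  let ?M = "keys p \<union> keys q"
  have "keys (p + q) \<subseteq> ?M"
    by (rule Poly_Mapping.keys_add)
  then show ?thesis
    by (simp add: insertion_superset[of ?M] lookup_add hom_add distrib_right sum.distrib)
qed

lemma insertion_sum: "insertion \<phi> \<sigma> (\<Sum>i\<in>I. f i) = (\<Sum>i\<in>I. insertion \<phi> \<sigma> (f i))"
proof -
  have "insertion \<phi> \<sigma> 0 = 0"
    by (simp add: insertion_def)
  then show ?thesis
    by (induction I rule: infinite_finite_induct) (auto simp: insertion_add)
qed

lemma insertion_mult: "insertion \<phi> \<sigma> (p * q) = insertion \<phi> \<sigma> p * insertion \<phi> \<sigma> q"
proof -
  have "p * q = (\<Sum>m\<in>keys p. \<Sum>m'\<in>keys q. single (m + m') (lookup p m * lookup q m'))"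
    by (subst (1 2) sum_single_lookup[symmetric]) (simp only: sum_product mult_single)
  also have "insertion \<phi> \<sigma> \<dots> = (\<Sum>m\<in>keys p. \<Sum>m'\<in>keys q.
      (\<phi> (lookup p m) * monom_val \<sigma> m) * (\<phi> (lookup q m') * monom_val \<sigma> m'))"
    by (simp add: insertion_sum insertion_single monom_val_add hom_mult mult_ac)
  finally show ?thesis
    by (simp only: sum_product insertion_def)
qed

lemma comm_ring_hom_insertion: "comm_ring_hom (insertion \<phi> \<sigma>)"
proof
  show "insertion \<phi> \<sigma> 1 = 1"
    using insertion_Const[of \<sigma> 1] by (simp add: Const_def)
qed (simp_all add: insertion_add insertion_mult insertion_def[of _ _ 0])

end

lemma hom_monom_val: "comm_ring_hom h \<Longrightarrow> h (monom_val \<sigma> m) = monom_val (\<lambda>v. h (\<sigma> v)) m"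
proof -
  assume "comm_ring_hom h"
  then interpret comm_ring_hom h .
  show ?thesis by (simp add: monom_val_def hom_distribs)
qed

lemma hom_insertion:
  assumes "comm_ring_hom h"
  shows "h (insertion \<phi> \<sigma> p) = insertion (\<lambda>c. h (\<phi> c)) (\<lambda>v. h (\<sigma> v)) p"
proof -
  interpret comm_ring_hom h by (rule assms)
  show ?thesis by (simp add: insertion_def hom_distribs hom_monom_val[OF assms])
qed

lemma comm_ring_hom_Const: "comm_ring_hom (Const :: 'k::field \<Rightarrow> ('v, 'k) mpoly)"
  by unfold_locales (auto simp: Const_def single_add mult_single)

lemma comm_ring_hom_id: "comm_ring_hom (\<lambda>c :: 'a::comm_ring_1. c)"
  by unfold_locales auto

lemma comm_ring_hom_poly: "comm_ring_hom (\<lambda>p. poly p (a :: 'a::comm_ring_1))"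
  by unfold_locales auto

lemmas comm_ring_hom_eval = comm_ring_hom_insertion[OF comm_ring_hom_id]
lemmas eval_Const [simp] = insertion_Const[OF comm_ring_hom_id]
lemmas eval_Var [simp] = insertion_Var[OF comm_ring_hom_id]
lemmas eval_single = insertion_single[OF comm_ring_hom_id]

lemma eval_insertion_Const:
  "eval x (insertion Const \<sigma> p) = eval (\<lambda>v. eval x (\<sigma> v)) p"
  by (simp add: hom_insertion[OF comm_ring_hom_eval])

lemma poly_insertion_const_poly:
  "poly (insertion (\<lambda>c. [:c:]) \<sigma> p) t = eval (\<lambda>v. poly (\<sigma> v) t) p"
  by (simp add: hom_insertion[OF comm_ring_hom_poly])

section \<open>Polynomials over an infinite field as functions\<close>

lemma poly_eq_0_of_zeros:
  fixes q :: "'k::field poly"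
  assumes "infinite (UNIV :: 'k set)" "\<And>t. poly q t = 0"
  shows "q = 0"
  using assms poly_roots_finite[of q] by auto

lemma poly_eq_of_eval:
  fixes q :: "'k::field poly"
  assumes "infinite (UNIV :: 'k set)" "\<And>t. poly q t = poly r t"
  shows "q = r"
  using poly_eq_0_of_zeros[of "q - r"] assms by simp

text \<open>Induction on the variables: when all values but that of u are fixed, the sum is a
  polynomial in the value of u, so its coefficients vanish. The coefficient of degree
  \<open>e m u\<close> collects the indices in \<open>?N\<close>, which the exponents of the
  remaining variables still separate. An abstract index set M carries the induction: it shrinks
  while the exponent functions stay unchanged.\<close>

lemma coeffs_zero_of_zeros:
  fixes c :: "'m \<Rightarrow> 'k::field" and e :: "'m \<Rightarrow> 'v \<Rightarrow> nat"
  assumes inf: "infinite (UNIV :: 'k set)" and "finite V" "finite M"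
    and "\<And>m m'. m \<in> M \<Longrightarrow> m' \<in> M \<Longrightarrow> (\<forall>v\<in>V. e m v = e m' v) \<Longrightarrow> m = m'"
    and "\<And>x. (\<Sum>m\<in>M. c m * (\<Prod>v\<in>V. x v ^ e m v)) = 0"
    and "m \<in> M"
  shows "c m = 0"
  using assms(2-)
proof (induction V arbitrary: M m rule: finite_induct)
  case empty
  then have "M = {m}" by blast
  with empty.prems(3) show ?case by simp
next
  case (insert u V)
  let ?q = "\<lambda>x. \<Sum>m\<in>M. Polynomial.monom (c m * (\<Prod>v\<in>V. x v ^ e m v)) (e m u)"
  let ?N = "{m' \<in> M. e m' u = e m u}"
  have "(\<Sum>m\<in>?N. c m * (\<Prod>v\<in>V. x v ^ e m v)) = 0" for x
  proof -
    have "poly (?q x) t = 0" for t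
    proof -
      have "(\<Prod>v\<in>V. (x(u := t)) v ^ e m v) = (\<Prod>v\<in>V. x v ^ e m v)" for m
        using insert.hyps by (intro prod.cong) auto
      then show ?thesis
        using insert.prems(3)[of "x(u := t)"] insert.hyps
        by (simp add: poly_sum poly_monom mult_ac)
    qed
    then have "?q x = 0"
      by (rule poly_eq_0_of_zeros[OF inf])
    then have "Polynomial.coeff (?q x) (e m u) = 0" by simp
    then show ?thesis
      using insert.prems(1) by (simp add: coeff_sum sum.If_cases Int_def)
  qed
  then show ?case
    using insert.prems by (intro insert.IH[of ?N m]) auto
qed

lemma eval_eq_0_imp_eq_0:
  fixes p :: "('v, 'k::field) mpoly"
  assumes inf: "infinite (UNIV :: 'k set)" and z: "\<And>x. eval x p = 0"
  shows "p = 0"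
proof (rule poly_mapping_eqI)
  fix m
  let ?V = "\<Union>(keys ` keys p)"
  have "lookup p m = 0" if "m \<in> keys p"
  proof (rule coeffs_zero_of_zeros[OF inf, of ?V "keys p" lookup "lookup p"])
    fix m m' assume mm: "m \<in> keys p" "m' \<in> keys p" "\<forall>v\<in>?V. lookup m v = lookup m' v"
    show "m = m'"
    proof (rule poly_mapping_eqI)
      fix v show "lookup m v = lookup m' v"
        using mm by (cases "v \<in> ?V") (auto simp: in_keys_iff)
    qed
  next
    fix x :: "'v \<Rightarrow> 'k"
    have "(\<Prod>v\<in>?V. x v ^ lookup m v) = monom_val x m" if "m \<in> keys p" for m
      using that by (intro monom_val_superset[symmetric]) auto
    then show "(\<Sum>m\<in>keys p. lookup p m * (\<Prod>v\<in>?V. x v ^ lookup m v)) = 0"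
      using z[of x] by (simp add: insertion_def)
  qed (use that in auto)
  then show "lookup p m = lookup 0 m"
    by (auto simp: in_keys_iff)
qed

lemma eval_eq_imp_eq:
  fixes p :: "('v, 'k::field) mpoly"
  assumes "infinite (UNIV :: 'k set)" "\<And>x. eval x p = eval x q"
  shows "p = q"
proof -
  have "eval x (p - q) = 0" for x
  proof -
    interpret comm_ring_hom "eval x" by (rule comm_ring_hom_eval)
    show ?thesis by (simp add: hom_minus assms)
  qed
  then show ?thesis
    using eval_eq_0_imp_eq_0[of "p - q"] assms(1) by simp
qed

section \<open>Subalgebras and generated subalgebras\<close>

lemma is_subalgebra_poly_ring: "is_subalgebra (poly_ring V)"
  unfolding is_subalgebra_def
proof (intro conjI ballI)
  show "range Const \<subseteq> poly_ring V"
    by (auto simp: Const_def poly_ring_def split: if_splits)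
next
  fix p q :: "('a, 'b) mpoly"
  assume pq: "p \<in> poly_ring V" "q \<in> poly_ring V"
  then show "p + q \<in> poly_ring V"
    using Poly_Mapping.keys_add[of p q] by (auto simp: poly_ring_def)
  show "p * q \<in> poly_ring V"
    unfolding poly_ring_def
  proof (intro CollectI ballI)
    fix m assume "m \<in> keys (p * q)"
    then obtain a b where "m = a + b" "a \<in> keys p" "b \<in> keys q"
      using keys_mult[of p q] by auto
    then show "keys m \<subseteq> V"
      using pq Poly_Mapping.keys_add[of a b] unfolding poly_ring_def by blast
  qed
qed

context
  fixes A :: "('v, 'k::field) mpoly set"
  assumes A: "is_subalgebra A"
begin

lemma subalgebra_Const: "Const c \<in> A"
  and subalgebra_add: "p \<in> A \<Longrightarrow> q \<in> A \<Longrightarrow> p + q \<in> A"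
  and subalgebra_mult: "p \<in> A \<Longrightarrow> q \<in> A \<Longrightarrow> p * q \<in> A"
  using A by (auto simp: is_subalgebra_def)

lemma subalgebra_zero: "0 \<in> A" and subalgebra_one: "1 \<in> A"
  using subalgebra_Const[of 0] subalgebra_Const[of 1] by (auto simp: Const_def)

lemma subalgebra_sum: "(\<And>i. i \<in> I \<Longrightarrow> f i \<in> A) \<Longrightarrow> sum f I \<in> A"
  by (induction I rule: infinite_finite_induct) (auto intro: subalgebra_zero subalgebra_add)

lemma subalgebra_power: "p \<in> A \<Longrightarrow> p ^ k \<in> A"
  by (induction k) (auto intro: subalgebra_one subalgebra_mult)

lemma subalgebra_prod: "(\<And>i. i \<in> I \<Longrightarrow> f i \<in> A) \<Longrightarrow> prod f I \<in> A"
  by (induction I rule: infinite_finite_induct) (auto intro: subalgebra_one subalgebra_mult)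

lemma subalgebra_monom_val: "(\<And>v. v \<in> keys m \<Longrightarrow> \<sigma> v \<in> A) \<Longrightarrow> monom_val \<sigma> m \<in> A"
  unfolding monom_val_def by (intro subalgebra_prod subalgebra_power)

lemma subalgebra_insertion:
  "p \<in> poly_ring V \<Longrightarrow> (\<And>v. v \<in> V \<Longrightarrow> \<sigma> v \<in> A) \<Longrightarrow> insertion Const \<sigma> p \<in> A"
  unfolding insertion_def
  by (intro subalgebra_sum subalgebra_mult subalgebra_Const subalgebra_monom_val)
    (auto simp: poly_ring_def)

end

lemma subalgebra_diff: "is_subalgebra A \<Longrightarrow> p \<in> A \<Longrightarrow> q \<in> A \<Longrightarrow> p - q \<in> A"
proof -
  assume A: "is_subalgebra A" "p \<in> A" "q \<in> A"
  have "Const (- 1) * q = - q"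
    by (metis Const_def mult_minus1 single_one single_uminus)
  then show ?thesis
    using subalgebra_add[OF A(1,2) subalgebra_mult[OF A(1) subalgebra_Const[OF A(1)] A(3)], of "- 1"]
    by simp
qed

lemma is_subalgebra_algebra_gen: "is_subalgebra (algebra_gen S)"
  unfolding algebra_gen_def by (rule hull_in) (auto simp: is_subalgebra_def)

lemma algebra_gen_superset: "S \<subseteq> algebra_gen S"
  unfolding algebra_gen_def by (rule hull_subset)

lemma algebra_gen_minimal: "S \<subseteq> A \<Longrightarrow> is_subalgebra A \<Longrightarrow> algebra_gen S \<subseteq> A"
  unfolding algebra_gen_def by (rule hull_minimal)

section \<open>The coefficients of the determinant of a pencil\<close>

text \<open>Exponent vector of the term of the Leibniz expansion of det(X + Y) in which column j
  contributes its entry in row \<open>\<pi> j\<close>, taken from X for j in S and from Y otherwise.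
  Indexing by columns matches the order of the variables.\<close>

definition det_monom :: "nat \<Rightarrow> (nat \<Rightarrow> nat) \<Rightarrow> nat set \<Rightarrow> tvar \<Rightarrow>\<^sub>0 nat" where
  "det_monom n \<pi> S = (\<Sum>j<n. single (\<pi> j, j, if j \<in> S then 0 else 1) 1)"

lemma lookup_det_monom:
  "lookup (det_monom n \<pi> S) (i, j, k) =
     (if j < n \<and> i = \<pi> j \<and> k = (if j \<in> S then 0 else 1) then 1 else 0)"
proof -
  have "lookup (det_monom n \<pi> S) (i, j, k) =
      (\<Sum>l<n. if l = j then (if i = \<pi> j \<and> k = (if j \<in> S then 0 else 1) then 1 else 0) else 0)"
    unfolding det_monom_def lookup_sum lookup_single when_def by (intro sum.cong) auto
  then show ?thesis by (simp add: sum.delta)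
qed

lemma keys_det_monom:
  "keys (det_monom n \<pi> S) = (\<lambda>j. (\<pi> j, j, if j \<in> S then 0 else 1)) ` {..<n}"
proof (rule Set.set_eqI)
  fix v :: tvar
  obtain i j k where "v = (i, j, k)" by (cases v) auto
  then show "v \<in> keys (det_monom n \<pi> S) \<longleftrightarrow> v \<in> (\<lambda>j. (\<pi> j, j, if j \<in> S then 0 else 1)) ` {..<n}"
    by (auto simp: in_keys_iff lookup_det_monom)
qed

lemma sum_keys_det_monom:
  "(\<Sum>v\<in>keys (det_monom n \<pi> S). g v) = (\<Sum>j<n. g (\<pi> j, j, if j \<in> S then 0 else 1))"
  unfolding keys_det_monom by (subst sum.reindex) (auto simp: inj_on_def)

lemma slice_deg_det_monom:
  assumes "S \<subseteq> {..<n}"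
  shows "slice_deg 0 (det_monom n \<pi> S) = card S" "slice_deg 1 (det_monom n \<pi> S) = n - card S"
proof -
  have *: "slice_deg k m = (\<Sum>v\<in>keys m. if snd (snd v) = k then lookup m v else 0)" for k m
    unfolding slice_deg_def by (rule sum.mono_neutral_cong_left) auto
  have "slice_deg 0 (det_monom n \<pi> S) = (\<Sum>j<n. if j \<in> S then 1 else 0)"
    unfolding * sum_keys_det_monom by (intro sum.cong) (auto simp: lookup_det_monom)
  also have "\<dots> = card S"
    using assms by (simp add: sum.If_cases Int_absorb1)
  finally show "slice_deg 0 (det_monom n \<pi> S) = card S" .
  have "slice_deg 1 (det_monom n \<pi> S) = (\<Sum>j<n. if j \<in> S then 0 else 1)"
    unfolding * sum_keys_det_monom by (intro sum.cong) (auto simp: lookup_det_monom)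
  also have "\<dots> = card ({..<n} - S)"
    by (simp add: sum.If_cases Diff_eq)
  also have "\<dots> = n - card S"
    using assms by (simp add: card_Diff_subset finite_subset)
  finally show "slice_deg 1 (det_monom n \<pi> S) = n - card S" .
qed

lemma mdeg_det_monom: "mdeg (det_monom n \<pi> S) = n"
  unfolding mdeg_def sum_keys_det_monom by (simp add: lookup_det_monom)

lemma monom_val_det_monom:
  "monom_val x (det_monom n \<pi> S) = (\<Prod>j<n. x (\<pi> j, j, if j \<in> S then 0 else 1))"
  unfolding monom_val_def keys_det_monom
  by (subst prod.reindex) (auto simp: inj_on_def lookup_det_monom intro!: prod.cong)

lemma lookup_bihom_part:
  "lookup (bihom_part a b p) m = (if slice_deg 0 m = a \<and> slice_deg 1 m = b then lookup p m else 0)"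
proof -
  have "lookup (bihom_part a b p) m = (\<Sum>m' | m' \<in> keys p \<and> slice_deg 0 m' = a \<and> slice_deg 1 m' = b.
      if m' = m then lookup p m else 0)"
    unfolding bihom_part_def lookup_sum by (intro sum.cong) (auto simp: lookup_single when_def)
  then show ?thesis
    by (auto simp: in_keys_iff sum.delta)
qed

lemma prod_choice:
  fixes f :: "nat \<Rightarrow> nat \<Rightarrow> 'b::comm_ring_1"
  shows "(\<Prod>j<n. f j 0 + f j 1) = (\<Sum>S\<in>Pow {..<n}. \<Prod>j<n. f j (if j \<in> S then 0 else 1))"
proof -
  have "(\<Prod>j<n. f j 0 + f j 1) = (\<Sum>S\<in>Pow {..<n}. (\<Prod>j\<in>S. f j 0) * (\<Prod>j\<in>{..<n} - S. f j 1))"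
    by (rule prod_add) simp
  also have "\<dots> = (\<Sum>S\<in>Pow {..<n}. \<Prod>j<n. f j (if j \<in> S then 0 else 1))"
  proof (rule sum.cong[OF refl])
    fix S assume "S \<in> Pow {..<n}"
    then show "(\<Prod>j\<in>S. f j 0) * (\<Prod>j\<in>{..<n} - S. f j 1) = (\<Prod>j<n. f j (if j \<in> S then 0 else 1))"
      by (subst prod.subset_diff[of S "{..<n}" "\<lambda>j. f j (if j \<in> S then 0 else 1)"])
        (auto simp: mult.commute)
  qed
  finally show ?thesis .
qed

lemma det_slice_sum:
  "det (slice n 0 + slice n 1 :: (tvar, 'k::field) mpoly mat) =
     (\<Sum>\<pi> | \<pi> permutes {0..<n}. \<Sum>S\<in>Pow {..<n}. single (det_monom n \<pi> S) (signof \<pi>))"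
proof -
  have *: "(\<Prod>j<n. Var (\<pi> j, j, c j)) = single (\<Sum>j<n. single (\<pi> j, j, c j) 1) (1::'k)" for \<pi> c
    by (induction n) (auto simp: Var_def mult_single)
  have "det (slice n 0 + slice n 1 :: (tvar, 'k) mpoly mat) =
    (\<Sum>\<pi> | \<pi> permutes {0..<n}. signof \<pi> *
      (\<Prod>j<n. (slice n 0 + slice n 1 :: (tvar, 'k) mpoly mat) $$ (\<pi> j, j)))"
    by (rule det_col) (simp add: slice_def)
  also have "\<dots> = (\<Sum>\<pi> | \<pi> permutes {0..<n}. signof \<pi> *
      (\<Prod>j<n. Var (\<pi> j, j, 0) + Var (\<pi> j, j, 1)))"
  proof (intro sum.cong refl arg_cong2[where f = "(*)"] prod.cong)
    fix \<pi> j assume "\<pi> \<in> {\<pi>. \<pi> permutes {0..<n}}" "j \<in> {..<n}"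
    then have "\<pi> j < n" "j < n"
      using permutes_in_image[of \<pi> "{0..<n}" j] by auto
    then show "(slice n 0 + slice n 1) $$ (\<pi> j, j) = (Var (\<pi> j, j, 0) + Var (\<pi> j, j, 1) :: (tvar, 'k) mpoly)"
      by (simp add: slice_def)
  qed
  also have "\<dots> = (\<Sum>\<pi> | \<pi> permutes {0..<n}. \<Sum>S\<in>Pow {..<n}.
      signof \<pi> * single (det_monom n \<pi> S) 1)"
  proof (intro sum.cong refl)
    fix \<pi> :: "nat \<Rightarrow> nat"
    have "(\<Prod>j<n. Var (\<pi> j, j, 0) + Var (\<pi> j, j, 1)) =
        (\<Sum>S\<in>Pow {..<n}. single (det_monom n \<pi> S) (1::'k))"
      unfolding det_monom_def * [symmetric] by (rule prod_choice)
    then show "signof \<pi> * (\<Prod>j<n. Var (\<pi> j, j, 0) + Var (\<pi> j, j, 1)) =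
        (\<Sum>S\<in>Pow {..<n}. signof \<pi> * single (det_monom n \<pi> S) (1::'k))"
      by (simp only: sum_distrib_left)
  qed
  also have "\<dots> = (\<Sum>\<pi> | \<pi> permutes {0..<n}. \<Sum>S\<in>Pow {..<n}. single (det_monom n \<pi> S) (signof \<pi>))"
    by (intro sum.cong refl) (auto simp: sign_def single_uminus)
  finally show ?thesis .
qed

text \<open>The term for (\<pi>, S) has bidegree (|S|, n - |S|), so selecting a bihomogeneous part
  means fixing the size of S.\<close>

lemma f_inv_eq:
  assumes "k \<le> n"
  shows "(f_inv n k (n - k) :: (tvar, 'k::field) mpoly) =
    (\<Sum>\<pi> | \<pi> permutes {0..<n}. \<Sum>S | S \<subseteq> {..<n} \<and> card S = k. single (det_monom n \<pi> S) (signof \<pi>))"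
proof (rule poly_mapping_eqI)
  fix m
  let ?c = "\<lambda>\<pi> S. (signof \<pi> when det_monom n \<pi> S = m) :: 'k"
  have "lookup (f_inv n k (n - k) :: (tvar, 'k) mpoly) m =
      (if slice_deg 0 m = k \<and> slice_deg 1 m = n - k
       then \<Sum>\<pi> | \<pi> permutes {0..<n}. \<Sum>S\<in>Pow {..<n}. ?c \<pi> S else 0)"
    unfolding f_inv_def lookup_bihom_part det_slice_sum lookup_sum lookup_single ..
  also have "\<dots> = (\<Sum>\<pi> | \<pi> permutes {0..<n}. \<Sum>S\<in>Pow {..<n}. if card S = k then ?c \<pi> S else 0)"
    using assms by (auto simp: slice_deg_det_monom when_def simp del: One_nat_def intro!: sum.cong sum.neutral)
  also have "\<dots> = (\<Sum>\<pi> | \<pi> permutes {0..<n}. \<Sum>S | S \<subseteq> {..<n} \<and> card S = k. ?c \<pi> S)"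
    by (rule sum.cong[OF refl], rule sum.mono_neutral_cong_right) auto
  also have "\<dots> = lookup (\<Sum>\<pi> | \<pi> permutes {0..<n}. \<Sum>S | S \<subseteq> {..<n} \<and> card S = k.
      single (det_monom n \<pi> S) (signof \<pi>)) m"
    by (simp add: lookup_sum lookup_single)
  finally show "lookup (f_inv n k (n - k) :: (tvar, 'k) mpoly) m = \<dots>" .
qed

text \<open>A pencil as an assignment of values to the variables. An element of
  \<open>poly_ring (tvars n)\<close> reads it only at i, j < n and k < 2.\<close>

definition pencil_point :: "'k mat \<Rightarrow> 'k mat \<Rightarrow> tvar \<Rightarrow> 'k" where
  "pencil_point X Y = (\<lambda>(i, j, k). if k = 0 then X $$ (i, j) else Y $$ (i, j))"

abbreviation f_inv_at :: "nat \<Rightarrow> 'k mat \<Rightarrow> 'k::field mat \<Rightarrow> nat \<Rightarrow> 'k" where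
  "f_inv_at n X Y k \<equiv> eval (pencil_point X Y) (f_inv n k (n - k))"

text \<open>Each entry taken from X brings a factor t, so the term for S carries t^|S|. The f's thus
  appear as the coefficients of det(tX + Y); their invariance and their values on the section are
  read off from this identity instead of from monomials.\<close>

lemma det_pencil:
  fixes X Y :: "'k::field mat"
  assumes "X \<in> carrier_mat n n" "Y \<in> carrier_mat n n"
  shows "det (t \<cdot>\<^sub>m X + Y) = (\<Sum>k\<le>n. f_inv_at n X Y k * t ^ k)"
proof -
  let ?x = "pencil_point X Y"
  let ?p = "\<lambda>\<pi> S. signof \<pi> * (\<Prod>j<n. ?x (\<pi> j, j, if j \<in> S then 0 else 1)) :: 'k"
  have f: "f_inv_at n X Y k = (\<Sum>\<pi> | \<pi> permutes {0..<n}. \<Sum>S | S \<subseteq> {..<n} \<and> card S = k. ?p \<pi> S)"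
    if "k \<le> n" for k
    using that by (simp add: f_inv_eq insertion_sum[OF comm_ring_hom_id] eval_single monom_val_det_monom)
  have "det (t \<cdot>\<^sub>m X + Y) = (\<Sum>\<pi> | \<pi> permutes {0..<n}. signof \<pi> * (\<Prod>j<n. (t \<cdot>\<^sub>m X + Y) $$ (\<pi> j, j)))"
    using assms by (intro det_col) auto
  also have "\<dots> = (\<Sum>\<pi> | \<pi> permutes {0..<n}. signof \<pi> *
      (\<Prod>j<n. t * ?x (\<pi> j, j, 0) + 1 * ?x (\<pi> j, j, 1)))"
  proof (intro sum.cong refl arg_cong2[where f = "(*)"] prod.cong)
    fix \<pi> j assume "\<pi> \<in> {\<pi>. \<pi> permutes {0..<n}}" "j \<in> {..<n}"
    then have "\<pi> j < n" "j < n"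
      using permutes_in_image[of \<pi> "{0..<n}" j] by auto
    then show "(t \<cdot>\<^sub>m X + Y) $$ (\<pi> j, j) = t * ?x (\<pi> j, j, 0) + 1 * ?x (\<pi> j, j, 1)"
      using assms by (simp add: pencil_point_def)
  qed
  also have "\<dots> = (\<Sum>\<pi> | \<pi> permutes {0..<n}. \<Sum>S\<in>Pow {..<n}. ?p \<pi> S * t ^ card S)"
  proof (intro sum.cong refl)
    fix \<pi>
    let ?f = "\<lambda>j k. (if k = 0 then t else 1) * ?x (\<pi> j, j, k)"
    have "(\<Prod>j<n. t * ?x (\<pi> j, j, 0) + 1 * ?x (\<pi> j, j, 1)) = (\<Prod>j<n. ?f j 0 + ?f j 1)"
      by simp
    also have "\<dots> = (\<Sum>S\<in>Pow {..<n}. \<Prod>j<n. ?f j (if j \<in> S then 0 else 1))"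
      by (rule prod_choice)
    also have "\<dots> = (\<Sum>S\<in>Pow {..<n}. \<Prod>j<n. (if j \<in> S then t else 1) * ?x (\<pi> j, j, if j \<in> S then 0 else 1))"
      by (intro sum.cong prod.cong refl) auto
    also have "\<dots> = (\<Sum>S\<in>Pow {..<n}. t ^ card S * (\<Prod>j<n. ?x (\<pi> j, j, if j \<in> S then 0 else 1)))"
      by (intro sum.cong refl) (auto simp: prod.distrib prod.If_cases Int_absorb1)
    finally show "signof \<pi> * (\<Prod>j<n. t * ?x (\<pi> j, j, 0) + 1 * ?x (\<pi> j, j, 1)) =
        (\<Sum>S\<in>Pow {..<n}. ?p \<pi> S * t ^ card S)"
      by (simp add: sum_distrib_left mult_ac)
  qed
  also have "\<dots> = (\<Sum>\<pi> | \<pi> permutes {0..<n}. \<Sum>k\<le>n. \<Sum>S | S \<in> Pow {..<n} \<and> card S = k. ?p \<pi> S * t ^ card S)"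
  proof (intro sum.cong refl sum.group[symmetric])
    show "card ` Pow {..<n} \<subseteq> {..n}"
      using card_mono[of "{..<n}"] by fastforce
  qed auto
  also have "\<dots> = (\<Sum>k\<le>n. f_inv_at n X Y k * t ^ k)"
    by (subst sum.swap) (simp add: f sum_distrib_right)
  finally show ?thesis .
qed

text \<open>The bridge from a determinant computed for every scalar t to the values of the f's: over
  an infinite field a polynomial function of t determines its coefficients.\<close>

lemma f_inv_at_eqI:
  fixes X Y :: "'k::field mat"
  assumes inf: "infinite (UNIV :: 'k set)"
    and XY: "X \<in> carrier_mat n n" "Y \<in> carrier_mat n n"
    and c: "\<And>t. det (t \<cdot>\<^sub>m X + Y) = (\<Sum>k\<le>n. c k * t ^ k)"
    and "k \<le> n"
  shows "f_inv_at n X Y k = c k"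
proof -
  let ?q = "\<lambda>c. \<Sum>k\<le>n. Polynomial.monom (c k :: 'k) k"
  have "?q (f_inv_at n X Y) = ?q c"
    by (rule poly_eq_of_eval[OF inf])
      (simp only: poly_sum poly_monom det_pencil[OF XY, symmetric] c)
  then have "Polynomial.coeff (?q (f_inv_at n X Y)) k = Polynomial.coeff (?q c) k" by simp
  then show ?thesis
    using \<open>k \<le> n\<close> by (simp add: coeff_sum)
qed

lemma f_inv_in_poly_ring: "k \<le> n \<Longrightarrow> f_inv n k (n - k) \<in> poly_ring (tvars n)"
proof -
  assume "k \<le> n"
  have "single (det_monom n \<pi> S) c \<in> poly_ring (tvars n)" if "\<pi> permutes {0..<n}" for \<pi> S and c :: 'a
  proof -
    have "\<pi> j < n" if "j < n" for j
      using permutes_in_image[OF \<open>\<pi> permutes {0..<n}\<close>, of j] that by simp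
    then have "keys (det_monom n \<pi> S) \<subseteq> tvars n"
      unfolding keys_det_monom tvars_def by auto
    then show ?thesis
      by (simp add: poly_ring_def)
  qed
  then show ?thesis
    unfolding f_inv_eq[OF \<open>k \<le> n\<close>]
    by (intro subalgebra_sum[OF is_subalgebra_poly_ring]) auto
qed

section \<open>The group action and the section\<close>

definition slice_at :: "nat \<Rightarrow> nat \<Rightarrow> (tvar \<Rightarrow> 'k) \<Rightarrow> 'k mat" where
  "slice_at n k x = mat n n (\<lambda>(i, j). x (i, j, k))"

lemma slice_at_carrier [simp]: "slice_at n k x \<in> carrier_mat n n"
  by (simp add: slice_at_def)

lemma mult_carrier_square [simp]:
  "A \<in> carrier_mat n n \<Longrightarrow> B \<in> carrier_mat n n \<Longrightarrow> A * B \<in> carrier_mat n n"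
  by (rule mult_carrier_mat)

lemma tvarsE:
  assumes "v \<in> tvars n"
  obtains i j k where "v = (i, j, k)" "i < n" "j < n" "k = 0 \<or> k = 1"
  using assms by (auto simp: tvars_def less_2_cases_iff)

lemma eval_pencil_point_slice_at:
  assumes "p \<in> poly_ring (tvars n)"
  shows "eval (pencil_point (slice_at n 0 x) (slice_at n 1 x)) p = eval x p"
proof (rule insertion_cong[OF assms])
  fix v assume "v \<in> tvars n"
  then obtain i j k where "v = (i, j, k)" "i < n" "j < n" "k = 0 \<or> k = 1"
    by (rule tvarsE)
  then show "pencil_point (slice_at n 0 x) (slice_at n 1 x) v = x v"
    by (auto simp: pencil_point_def slice_at_def)
qed

lemma slice_at_pencil_point:
  assumes "X \<in> carrier_mat n n" "Y \<in> carrier_mat n n"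
  shows "slice_at n 0 (pencil_point X Y) = X" "slice_at n 1 (pencil_point X Y) = Y"
  using assms by (auto simp: slice_at_def pencil_point_def)

text \<open>Evaluation turns the substitution defining the action into a map on pencils, (X, Y) to
  (P^T X Q, P^T Y Q), and so makes invariance a statement about values at points.\<close>

lemma eval_act:
  fixes P Q :: "'k::field mat"
  assumes p: "p \<in> poly_ring (tvars n)" and P: "P \<in> carrier_mat n n" and Q: "Q \<in> carrier_mat n n"
  shows "eval x (act n P Q p) =
    eval (pencil_point (P\<^sup>T * slice_at n 0 x * Q) (P\<^sup>T * slice_at n 1 x * Q)) p"
proof -
  interpret E: comm_ring_hom "eval x" by (rule comm_ring_hom_eval)
  let ?M = "\<lambda>k. map_mat Const P\<^sup>T * slice n k * map_mat Const Q"
  have hom: "map_mat (eval x) (?M k) = P\<^sup>T * slice_at n k x * Q" for k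
  proof -
    have s: "map_mat (eval x) (slice n k) = slice_at n k x"
      by (rule eq_matI) (auto simp: slice_def slice_at_def)
    have C: "map_mat (eval x) (map_mat Const A) = A" for A
      by (rule eq_matI) auto
    have "map_mat (eval x) (?M k) =
        map_mat (eval x) (map_mat Const P\<^sup>T * slice n k) * map_mat (eval x) (map_mat Const Q)"
      using P Q by (intro E.mat_hom_mult[of _ n n _ n]) (auto simp: slice_def)
    also have "map_mat (eval x) (map_mat Const P\<^sup>T * slice n k) =
        map_mat (eval x) (map_mat Const P\<^sup>T) * map_mat (eval x) (slice n k)"
      using P by (intro E.mat_hom_mult[of _ n n _ n]) (auto simp: slice_def)
    finally show ?thesis by (simp only: s C)
  qed
  have "eval x (act n P Q p) = eval (\<lambda>v. eval x (case v of (i, j, k) \<Rightarrow> ?M k $$ (i, j))) p"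
    unfolding act_def subst_eq_insertion by (rule eval_insertion_Const)
  also have "\<dots> = eval (pencil_point (P\<^sup>T * slice_at n 0 x * Q) (P\<^sup>T * slice_at n 1 x * Q)) p"
  proof (rule insertion_cong[OF p])
    fix v assume "v \<in> tvars n"
    then obtain i j k where v: "v = (i, j, k)" "i < n" "j < n" "k = 0 \<or> k = 1"
      by (rule tvarsE)
    have "eval x (?M k $$ (i, j)) = map_mat (eval x) (?M k) $$ (i, j)"
      using v P Q by (intro index_map_mat(1)[symmetric]) (auto simp: slice_def)
    then show "eval x (case v of (i, j, k) \<Rightarrow> ?M k $$ (i, j)) =
        pencil_point (P\<^sup>T * slice_at n 0 x * Q) (P\<^sup>T * slice_at n 1 x * Q) v"
      using v unfolding hom pencil_point_def by auto
  qed
  finally show ?thesis .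
qed

lemma SL_transpose: "P \<in> SL n \<Longrightarrow> P\<^sup>T \<in> SL n"
  by (auto simp: SL_def det_transpose)

text \<open>Invariance is applied to the transpose of P, which lies in \<open>SL n\<close> again, so
  the transposition in the action disappears.\<close>

lemma invariant_ringD:
  assumes "p \<in> invariant_ring n" "P \<in> SL n" "Q \<in> SL n"
    and "X \<in> carrier_mat n n" "Y \<in> carrier_mat n n"
  shows "eval (pencil_point (P * X * Q) (P * Y * Q)) p = eval (pencil_point X Y) p"
proof -
  have "eval (pencil_point X Y) (act n P\<^sup>T Q p) = eval (pencil_point (P * X * Q) (P * Y * Q)) p"
    using assms eval_act[of p n "P\<^sup>T" Q "pencil_point X Y"]
    by (simp add: slice_at_pencil_point invariant_ring_def SL_def del: One_nat_def)
  then show ?thesis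
    using assms by (simp add: invariant_ring_def SL_transpose)
qed

lemma invariant_ringI:
  fixes p :: "(tvar, 'k::field) mpoly"
  assumes inf: "infinite (UNIV :: 'k set)" and p: "p \<in> poly_ring (tvars n)"
    and inv: "\<And>P Q X Y. P \<in> SL n \<Longrightarrow> Q \<in> SL n \<Longrightarrow> X \<in> carrier_mat n n \<Longrightarrow> Y \<in> carrier_mat n n \<Longrightarrow>
      eval (pencil_point (P * X * Q) (P * Y * Q)) p = eval (pencil_point X Y) p"
  shows "p \<in> invariant_ring n"
proof -
  have "act n P Q p = p" if "P \<in> SL n" "Q \<in> SL n" for P Q
  proof (rule eval_eq_imp_eq[OF inf])
    fix x
    have "eval x (act n P Q p) =
        eval (pencil_point (P\<^sup>T * slice_at n 0 x * Q) (P\<^sup>T * slice_at n 1 x * Q)) p"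
      using that by (intro eval_act p) (auto simp: SL_def)
    also have "\<dots> = eval x p"
      unfolding inv[OF SL_transpose[OF that(1)] that(2) slice_at_carrier slice_at_carrier]
      by (rule eval_pencil_point_slice_at[OF p])
    finally show "eval x (act n P Q p) = eval x p" .
  qed
  then show ?thesis
    using p by (simp add: invariant_ring_def)
qed

lemma is_subalgebra_invariant_ring: "is_subalgebra (invariant_ring n :: (tvar, 'k::field) mpoly set)"
proof -
  have "act n P Q (Const c) = Const c" "act n P Q (p + q) = act n P Q p + act n P Q q"
    "act n P Q (p * q) = act n P Q p * act n P Q q" for P Q :: "'k mat" and c p q
    unfolding act_def subst_eq_insertion
    by (simp_all add: insertion_Const[OF comm_ring_hom_Const]
        insertion_add[OF comm_ring_hom_Const] insertion_mult[OF comm_ring_hom_Const])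
  moreover note subalgebra_Const[OF is_subalgebra_poly_ring] subalgebra_add[OF is_subalgebra_poly_ring]
    subalgebra_mult[OF is_subalgebra_poly_ring]
  ultimately show ?thesis
    unfolding is_subalgebra_def invariant_ring_def by auto
qed

lemma smult_add_sandwich:
  fixes P Q X Y :: "'k::comm_ring_1 mat"
  assumes "P \<in> carrier_mat n n" "Q \<in> carrier_mat n n" "X \<in> carrier_mat n n" "Y \<in> carrier_mat n n"
  shows "t \<cdot>\<^sub>m (P * X * Q) + P * Y * Q = P * (t \<cdot>\<^sub>m X + Y) * Q"
proof -
  have "P * (t \<cdot>\<^sub>m X + Y) * Q = (P * (t \<cdot>\<^sub>m X) + P * Y) * Q"
    using assms by (simp add: mult_add_distrib_mat[of _ n n _ n])
  also have "\<dots> = P * (t \<cdot>\<^sub>m X) * Q + P * Y * Q"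
    using assms by (intro add_mult_distrib_mat[of _ n n _ _ n]) auto
  also have "P * (t \<cdot>\<^sub>m X) * Q = t \<cdot>\<^sub>m (P * X * Q)"
    using assms by (simp add: mult_smult_distrib[of _ n n _ n] mult_smult_assoc_mat[of _ n n _ n])
  finally show ?thesis by simp
qed

text \<open>det(t PXQ + PYQ) = det P * det(tX + Y) * det Q for every t, so only the product of the
  two determinants enters.\<close>

lemma f_inv_at_sandwich:
  fixes P Q X Y :: "'k::field mat"
  assumes inf: "infinite (UNIV :: 'k set)"
    and c: "P \<in> carrier_mat n n" "Q \<in> carrier_mat n n" "X \<in> carrier_mat n n" "Y \<in> carrier_mat n n"
    and "det P * det Q = 1" "k \<le> n"
  shows "f_inv_at n (P * X * Q) (P * Y * Q) k = f_inv_at n X Y k"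
proof (rule f_inv_at_eqI[OF inf])
  fix t
  have "det (t \<cdot>\<^sub>m (P * X * Q) + P * Y * Q) = det P * det (t \<cdot>\<^sub>m X + Y) * det Q"
    unfolding smult_add_sandwich[OF c] using c by (simp add: det_mult[of _ n])
  also have "\<dots> = det (t \<cdot>\<^sub>m X + Y)"
    using assms(6) by (simp add: mult_ac)
  finally show "det (t \<cdot>\<^sub>m (P * X * Q) + P * Y * Q) = (\<Sum>k\<le>n. f_inv_at n X Y k * t ^ k)"
    using c by (simp add: det_pencil)
qed (use assms in auto)

lemma f_inv_in_invariant_ring:
  assumes "infinite (UNIV :: 'k::field set)" "k \<le> n"
  shows "(f_inv n k (n - k) :: (tvar, 'k) mpoly) \<in> invariant_ring n"
  using assms by (intro invariant_ringI f_inv_in_poly_ring f_inv_at_sandwich) (auto simp: SL_def)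

section \<open>From SL(n) to pairs with reciprocal determinants\<close>

text \<open>Clearing denominators: a monomial of degree d contributes a^(-d), and N, the sum of the
  degrees of all monomials, is at least each d. Neither N nor R depends on a, so R can be compared
  with another polynomial in a.\<close>

lemma eval_divide_var:
  fixes p :: "('v, 'k::field) mpoly" and \<sigma> :: "'v \<Rightarrow> 'k poly"
  obtains N R where "\<And>a. a \<noteq> 0 \<Longrightarrow> a ^ N * eval (\<lambda>v. poly (\<sigma> v) a / a) p = poly R a"
proof
  let ?N = "\<Sum>m\<in>keys p. mdeg m"
  let ?R = "\<Sum>m\<in>keys p. Polynomial.smult (lookup p m) (Polynomial.monom 1 (?N - mdeg m) * monom_val \<sigma> m)"
  fix a :: 'k assume a: "a \<noteq> 0"
  have "a ^ ?N * monom_val (\<lambda>v. poly (\<sigma> v) a / a) m = a ^ (?N - mdeg m) * poly (monom_val \<sigma> m) a"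
    if "m \<in> keys p" for m
  proof -
    have "mdeg m \<le> ?N" using that by (intro member_le_sum) auto
    then have "a ^ ?N = a ^ (?N - mdeg m) * a ^ mdeg m" by (simp flip: power_add)
    moreover have "monom_val (\<lambda>v. poly (\<sigma> v) a / a) m = poly (monom_val \<sigma> m) a / a ^ mdeg m"
      by (simp add: monom_val_def power_divide prod_dividef poly_prod mdeg_def power_sum)
    ultimately show ?thesis using a by simp
  qed
  then show "a ^ ?N * eval (\<lambda>v. poly (\<sigma> v) a / a) p = poly ?R a"
    by (simp add: insertion_def sum_distrib_left poly_sum poly_monom mult.left_commute)
qed

text \<open>For n \<ge> 1 and a \<noteq> 0 this represents the class of determinant a in GL(n)
  modulo SL(n).\<close>

definition scale_first :: "nat \<Rightarrow> 'k \<Rightarrow> 'k::field mat" where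
  "scale_first n a = mat n n (\<lambda>(i, j). if i = j then if i = 0 then a else 1 else 0)"

lemma scale_first_carrier [simp]: "scale_first n a \<in> carrier_mat n n"
  by (simp add: scale_first_def)

lemma det_scale_first: "n \<ge> 1 \<Longrightarrow> det (scale_first n a) = a"
proof -
  assume "n \<ge> 1"
  have "det (scale_first n a) = prod_list (diag_mat (scale_first n a))"
    by (rule det_upper_triangular[of _ n]) (auto simp: scale_first_def)
  also have "\<dots> = (\<Prod>i\<in>{0..<n}. if i = 0 then a else 1)"
    unfolding prod_list_diag_prod by (intro prod.cong) (auto simp: scale_first_def)
  also have "\<dots> = a"
    using \<open>n \<ge> 1\<close> by (simp add: prod.delta')
  finally show ?thesis .
qed

lemma scale_first_mult_left:
  "A \<in> carrier_mat n n \<Longrightarrow> scale_first n a * A = mat n n (\<lambda>(i, j). (if i = 0 then a else 1) * A $$ (i, j))"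
  by (rule eq_matI) (auto simp: scale_first_def scalar_prod_def if_distribR sum.delta if_distrib[of "\<lambda>x. x * _"] cong: if_cong)

lemma scale_first_mult_right:
  "A \<in> carrier_mat n n \<Longrightarrow> A * scale_first n a = mat n n (\<lambda>(i, j). A $$ (i, j) * (if j = 0 then a else 1))"
  by (rule eq_matI) (auto simp: scale_first_def scalar_prod_def sum.delta if_distrib[of "\<lambda>x. _ * x"] cong: if_cong)

lemma scale_first_inverse: "a * b = 1 \<Longrightarrow> scale_first n a * scale_first n b = 1\<^sub>m n"
  by (subst scale_first_mult_left) (auto simp: scale_first_def one_mat_def)

text \<open>For \<open>a = s ^ n\<close> the two matrices can be rescaled by \<open>1 / s\<close> and \<open>s\<close> into \<open>SL n\<close>. As a function
  of \<open>a\<close> the left-hand side is a Laurent polynomial, so being constant on all \<open>n\<close>-th powers, it is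
  constant.\<close>

lemma invariant_scale_first:
  fixes X Y :: "'k::field mat"
  assumes inf: "infinite (UNIV :: 'k set)" and n: "n \<ge> 1" and p: "p \<in> invariant_ring n"
    and X: "X \<in> carrier_mat n n" and Y: "Y \<in> carrier_mat n n" and "a \<noteq> 0"
  shows "eval (pencil_point (scale_first n a * X * scale_first n (1 / a))
      (scale_first n a * Y * scale_first n (1 / a))) p = eval (pencil_point X Y) p"
proof -
  let ?C = "\<lambda>a A. scale_first n a * A * scale_first n (1 / a)"
  let ?r = "\<lambda>a. eval (pencil_point (?C a X) (?C a Y)) p"
  let ?r1 = "eval (pencil_point X Y) p"
  \<comment> \<open>Entry (i, j) of the product carries the power of a with exponent [i = 0] -
    [j = 0], which may be -1. One is added to it here, and the division by a is left to
    \<open>eval_divide_var\<close>.\<close>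
  define \<sigma> where "\<sigma> = (\<lambda>(i, j, k). Polynomial.monom (pencil_point X Y (i, j, k))
    ((if i = 0 then 2 else 1) - (if j = 0 then 1 else 0)))"
  have p': "p \<in> poly_ring (tvars n)"
    using p by (simp add: invariant_ring_def)
  have r: "?r a = eval (\<lambda>v. poly (\<sigma> v) a / a) p" if "a \<noteq> 0" for a
  proof (rule insertion_cong[OF p'])
    fix v assume "v \<in> tvars n"
    then obtain i j k where v: "v = (i, j, k)" "i < n" "j < n" "k = 0 \<or> k = 1"
      by (rule tvarsE)
    have "?C a A $$ (i, j) = (if i = 0 then a else 1) * A $$ (i, j) * (if j = 0 then 1 / a else 1)"
      if "A \<in> carrier_mat n n" for A
      using that v by (simp add: scale_first_mult_left scale_first_mult_right)
    then show "pencil_point (?C a X) (?C a Y) v = poly (\<sigma> v) a / a"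
      using v X Y that unfolding pencil_point_def \<sigma>_def
      by (auto simp: poly_monom power2_eq_square)
  qed
  have r_power: "?r (s ^ n) = ?r1" if s: "s \<noteq> 0" for s
  proof -
    let ?P = "(1 / s) \<cdot>\<^sub>m scale_first n (s ^ n)" and ?Q = "s \<cdot>\<^sub>m scale_first n (1 / s ^ n)"
    have "?P \<in> SL n" "?Q \<in> SL n"
      using s n by (auto simp: SL_def det_scale_first power_divide carrier_matD(2)[OF scale_first_carrier])
    moreover have "?P * A * ?Q = ?C (s ^ n) A" if A: "A \<in> carrier_mat n n" for A
    proof -
      let ?S = "scale_first n (s ^ n)" and ?S' = "scale_first n (1 / s ^ n)"
      have "?P * A * ?Q = (1 / s) \<cdot>\<^sub>m (?S * A) * ?Q"
        using A by (simp add: mult_smult_assoc_mat[of _ n n _ n])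
      also have "\<dots> = (1 / s) \<cdot>\<^sub>m (?S * A * ?Q)"
        using A by (intro mult_smult_assoc_mat[of _ n n _ n]) auto
      also have "?S * A * ?Q = s \<cdot>\<^sub>m (?S * A * ?S')"
        using A by (intro mult_smult_distrib[of _ n n _ n]) auto
      also have "(1 / s) \<cdot>\<^sub>m (s \<cdot>\<^sub>m (?S * A * ?S')) = ?S * A * ?S'"
        using s by (intro eq_matI) auto
      finally show ?thesis .
    qed
    ultimately show ?thesis
      using invariant_ringD[OF p _ _ X Y, of ?P ?Q] X Y by simp
  qed
  obtain N R where R: "\<And>a. a \<noteq> 0 \<Longrightarrow> a ^ N * eval (\<lambda>v. poly (\<sigma> v) a / a) p = poly R a"
    using eval_divide_var[of \<sigma> p] by metis
  let ?q = "R - Polynomial.monom ?r1 N"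
  let ?Z = "Polynomial.monom 1 n :: 'k poly"
  \<comment> \<open>The factor \<open>Polynomial.monom 1 1\<close> vanishes at s = 0, where the
    rescaling by 1 / s is impossible, so that the product vanishes at every s.\<close>
  have "poly (Polynomial.monom 1 1 * pcompose ?q ?Z) s = 0" for s
  proof (cases "s = 0")
    case False
    then have "poly R (s ^ n) = (s ^ n) ^ N * ?r1"
      using R[of "s ^ n"] r[of "s ^ n"] r_power[of s] by simp
    then show ?thesis
      by (simp add: poly_pcompose poly_monom)
  qed (simp add: poly_monom)
  then have "Polynomial.monom 1 1 * pcompose ?q ?Z = 0"
    by (rule poly_eq_0_of_zeros[OF inf])
  then have "pcompose ?q ?Z = 0"
    by (metis monom_eq_0_iff mult_eq_0_iff zero_neq_one)
  \<comment> \<open>Composition with the n-th power, a polynomial of positive degree, is injective;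
    this carries the identity from n-th powers to all scalars.\<close>
  then have "?q = 0"
    by (rule pcompose_eq_0) (use n in \<open>simp add: degree_monom_eq\<close>)
  then have "poly ?q a = 0" by simp
  then have "a ^ N * ?r a = a ^ N * ?r1"
    using R[OF \<open>a \<noteq> 0\<close>] r[OF \<open>a \<noteq> 0\<close>] by (simp add: poly_monom mult.commute)
  then show ?thesis
    using \<open>a \<noteq> 0\<close> by simp
qed

text \<open>With E = diag(det S, 1, ..., 1), both E^-1 S and T E have determinant 1, and S A T = E
  ((E^-1 S) A (T E)) E^-1. The outer factors are handled by \<open>invariant_scale_first\<close>,
  the inner ones by invariance.\<close>

lemma invariant_sandwich:
  fixes X Y :: "'k::field mat"
  assumes inf: "infinite (UNIV :: 'k set)" and n: "n \<ge> 1" and p: "p \<in> invariant_ring n"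
    and X: "X \<in> carrier_mat n n" and Y: "Y \<in> carrier_mat n n"
    and S: "S \<in> carrier_mat n n" and T: "T \<in> carrier_mat n n" and det: "det S * det T = 1"
  shows "eval (pencil_point (S * X * T) (S * Y * T)) p = eval (pencil_point X Y) p"
proof -
  define a where "a = det S"
  have a: "a \<noteq> 0"
    using det by (auto simp: a_def)
  then have "det T = 1 / a"
    using det by (simp add: a_def field_simps)
  let ?E = "scale_first n a" and ?F = "scale_first n (1 / a)"
  have EF: "?E * ?F = 1\<^sub>m n"
    using a by (intro scale_first_inverse) auto
  have SL: "?F * S \<in> SL n" "T * ?E \<in> SL n"
    using S T a n \<open>det T = 1 / a\<close> by (auto simp: SL_def det_mult[of _ n] det_scale_first a_def)
  have *: "S * A * T = ?E * ((?F * S) * A * (T * ?E)) * ?F" if A: "A \<in> carrier_mat n n" for A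
  proof -
    have "?E * ((?F * S) * A * (T * ?E)) * ?F = (?E * ?F) * S * A * T * (?E * ?F)"
      using A S T by (simp add: assoc_mult_mat[of _ n n _ n _ n])
    then show ?thesis using A S T by (simp add: EF)
  qed
  have "eval (pencil_point (S * X * T) (S * Y * T)) p =
      eval (pencil_point (?F * S * X * (T * ?E)) (?F * S * Y * (T * ?E))) p"
    unfolding *[OF X] *[OF Y] using X Y S T a by (intro invariant_scale_first[OF inf n p]) auto
  also have "\<dots> = eval (pencil_point X Y) p"
    by (rule invariant_ringD[OF p SL X Y])
  finally show ?thesis .
qed

section \<open>The section and the values of the f's on it\<close>

text \<open>In the induction step the last column has only d (m + 1) at the top and t at the bottom,
  so Laplace expansion along it is a Horner step. The top minor is triangular with diagonal -1, and
  its determinant (-1)^(m + 1) cancels the cofactor sign; this is why the subdiagonal consists of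
  -1.\<close>

lemma det_hessenberg:
  fixes t :: "'a::idom"
  shows "det (mat (Suc m) (Suc m) (\<lambda>(i, j). if i = 0 then d j else if i = j then t else if i = Suc j then - 1 else 0))
    = (\<Sum>j\<le>m. d j * t ^ (m - j))"
proof (induction m)
  case 0
  show ?case by (subst det_single) auto
next
  case (Suc m)
  let ?f = "\<lambda>(i, j). if i = 0 then d j else if i = j then t else if i = Suc j then - 1 else 0"
  let ?A = "mat (Suc (Suc m)) (Suc (Suc m)) ?f"
  have "mat_delete ?A (Suc m) (Suc m) = mat (Suc m) (Suc m) ?f"
    by (rule eq_matI) (auto simp: mat_delete_def)
  then have c1: "cofactor ?A (Suc m) (Suc m) = (\<Sum>j\<le>m. d j * t ^ (m - j))"
    using Suc.IH by (simp add: cofactor_def)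
  have "mat_delete ?A 0 (Suc m) = mat (Suc m) (Suc m) (\<lambda>(i, j). if Suc i = j then t else if i = j then - 1 else 0)"
    (is "_ = ?U") by (rule eq_matI) (auto simp: mat_delete_def)
  moreover have "det ?U = (-1) ^ Suc m"
  proof -
    have "det ?U = prod_list (diag_mat ?U)"
      by (rule det_upper_triangular[of _ "Suc m"]) auto
    also have "\<dots> = (\<Prod>i\<in>{0..<Suc m}. - 1)"
      unfolding prod_list_diag_prod by (intro prod.cong) auto
    finally show ?thesis by simp
  qed
  ultimately have c0: "cofactor ?A 0 (Suc m) = 1"
    by (simp add: cofactor_def flip: power_mult_distrib)
  have "det ?A = (\<Sum>i<Suc (Suc m). ?A $$ (i, Suc m) * cofactor ?A i (Suc m))"
    by (rule laplace_expansion_column) auto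
  also have "\<dots> = (\<Sum>i<Suc (Suc m). (if i = 0 then d (Suc m) else 0) + (if i = Suc m then t * cofactor ?A i (Suc m) else 0))"
    by (intro sum.cong refl) (auto simp: c0)
  also have "\<dots> = d (Suc m) + t * (\<Sum>j\<le>m. d j * t ^ (m - j))"
    by (simp add: sum.distrib c1 sum.delta)
  also have "\<dots> = (\<Sum>j\<le>Suc m. d j * t ^ (Suc m - j))"
    by (simp add: sum_distrib_left Suc_diff_le mult_ac)
  finally show ?case .
qed

text \<open>Over an arbitrary commutative ring, so that c may consist of scalars or, in
  \<open>section_restrict\<close>, of the variables themselves.\<close>

definition section_X :: "nat \<Rightarrow> (nat \<Rightarrow> 'a) \<Rightarrow> 'a::comm_ring_1 mat" where
  "section_X n c = mat n n (\<lambda>(i, j). if i = j then if i = 0 then c n else 1 else 0)"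

definition section_Y :: "nat \<Rightarrow> (nat \<Rightarrow> 'a) \<Rightarrow> 'a::comm_ring_1 mat" where
  "section_Y n c = mat n n (\<lambda>(i, j). if i = 0 then c (n - 1 - j) else if i = Suc j then - 1 else 0)"

lemma section_carrier [simp]: "section_X n c \<in> carrier_mat n n" "section_Y n c \<in> carrier_mat n n"
  by (auto simp: section_X_def section_Y_def)

lemma f_inv_at_section:
  fixes c :: "nat \<Rightarrow> 'k::field"
  assumes inf: "infinite (UNIV :: 'k set)" and n: "n \<ge> 1" and "k \<le> n"
  shows "f_inv_at n (section_X n c) (section_Y n c) k = c k"
proof (rule f_inv_at_eqI[OF inf])
  fix t
  obtain m where m: "n = Suc m" using n by (cases n) auto
  \<comment> \<open>The (0, 0) entry is the only one to which both matrices contribute, c n from X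
    and c (n - 1) from Y. It takes the place of t on the diagonal.\<close>
  let ?d = "\<lambda>j. if j = 0 then c n * t + c m else c (m - j)"
  have "t \<cdot>\<^sub>m section_X n c + section_Y n c =
      mat (Suc m) (Suc m) (\<lambda>(i, j). if i = 0 then ?d j else if i = j then t else if i = Suc j then - 1 else 0)"
    unfolding section_X_def section_Y_def m by (rule eq_matI) auto
  then have "det (t \<cdot>\<^sub>m section_X n c + section_Y n c) = (\<Sum>j\<le>m. ?d j * t ^ (m - j))"
    by (simp only: det_hessenberg)
  also have "\<dots> = (\<Sum>j\<le>m. (if j = 0 then c n * t ^ Suc m else 0) + c (m - j) * t ^ (m - j))"
    by (intro sum.cong refl) (auto simp: algebra_simps)
  also have "\<dots> = c n * t ^ n + (\<Sum>j\<le>m. c (m - j) * t ^ (m - j))"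
    by (simp add: sum.distrib m)
  also have "(\<Sum>j\<le>m. c (m - j) * t ^ (m - j)) = (\<Sum>j\<le>m. c j * t ^ j)"
    using sum.atLeastAtMost_rev[of "\<lambda>j. c j * t ^ j" 0 m] by (simp add: atMost_atLeast0)
  finally show "det (t \<cdot>\<^sub>m section_X n c + section_Y n c) = (\<Sum>k\<le>n. c k * t ^ k)"
    by (simp add: m)
qed (use assms in auto)

section \<open>Normal forms of pencils and generation\<close>

lemma invertible_obtain:
  fixes A :: "'k::field mat"
  assumes A: "A \<in> carrier_mat n n" and "det A \<noteq> 0"
  obtains B where "B \<in> carrier_mat n n" "A * B = 1\<^sub>m n" "B * A = 1\<^sub>m n"
proof
  let ?B = "(1 / det A) \<cdot>\<^sub>m adj_mat A"
  note adj = adj_mat[OF A]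
  show "?B \<in> carrier_mat n n" using adj by simp
  have "(1 / det A) \<cdot>\<^sub>m (det A \<cdot>\<^sub>m 1\<^sub>m n) = 1\<^sub>m n"
    using assms by (intro eq_matI) auto
  then show "A * ?B = 1\<^sub>m n" "?B * A = 1\<^sub>m n"
    using assms adj by (simp_all add: mult_smult_distrib[OF A adj(1)] mult_smult_assoc_mat[OF adj(1) A])
qed

text \<open>The rows are, up to signs, the last unit row vector times \<open>W ^ (n - 1), \<dots>, W, 1\<close>; in this basis
  \<open>W\<close> has an arbitrary first row, entries \<open>- 1\<close> on the subdiagonal and \<open>0\<close> elsewhere.\<close>

definition krylov :: "nat \<Rightarrow> 'a::comm_ring_1 mat \<Rightarrow> 'a mat" where
  "krylov n W = mat n n (\<lambda>(i, j). (- 1) ^ (n - 1 - i) * (W ^\<^sub>m (n - 1 - i)) $$ (n - 1, j))"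

lemma krylov_carrier [simp]: "krylov n W \<in> carrier_mat n n"
  by (simp add: krylov_def)

text \<open>Multiplying the last unit row vector times W^k by W raises the power by one, which leads
  to the row above; the alternating signs in \<open>krylov\<close> turn this into the factor -1 of
  the subdiagonal.\<close>

lemma krylov_mult:
  assumes W: "W \<in> carrier_mat n n" and "Suc i < n" "j < n"
  shows "(krylov n W * W) $$ (Suc i, j) = - krylov n W $$ (i, j)"
proof -
  let ?k = "n - 1 - Suc i"
  have k: "n - 1 - i = Suc ?k" using assms by simp
  have Wk: "W ^\<^sub>m ?k \<in> carrier_mat n n" using W by (rule pow_carrier_mat)
  have "(krylov n W * W) $$ (Suc i, j) = (\<Sum>l<n. krylov n W $$ (Suc i, l) * W $$ (l, j))"
    using assms by (simp add: krylov_def scalar_prod_def atLeast0LessThan)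
  also have "\<dots> = (- 1) ^ ?k * (\<Sum>l<n. (W ^\<^sub>m ?k) $$ (n - 1, l) * W $$ (l, j))"
    using assms by (simp add: krylov_def sum_distrib_left mult.assoc)
  also have "(\<Sum>l<n. (W ^\<^sub>m ?k) $$ (n - 1, l) * W $$ (l, j)) = (W ^\<^sub>m ?k * W) $$ (n - 1, j)"
    using assms Wk by (simp add: scalar_prod_def atLeast0LessThan)
  finally have "(krylov n W * W) $$ (Suc i, j) = (- 1) ^ ?k * (W ^\<^sub>m ?k * W) $$ (n - 1, j)" .
  moreover have "krylov n W $$ (i, j) = (- 1) ^ (n - 1 - i) * (W ^\<^sub>m (n - 1 - i)) $$ (n - 1, j)"
    using assms by (simp add: krylov_def)
  ultimately show ?thesis
    by (simp only: k pow_mat.simps power_Suc mult_minus_left mult_1_left minus_minus)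
qed

text \<open>Used with h the evaluation of polynomials at t: along a line of matrices W, the
  determinant of the Krylov matrix is a polynomial in the parameter.\<close>

lemma hom_krylov:
  assumes "comm_ring_hom h" and W: "W \<in> carrier_mat n n"
  shows "map_mat h (krylov n W) = krylov n (map_mat h W)"
proof -
  interpret comm_ring_hom h by (rule assms)
  have "h ((W ^\<^sub>m k) $$ (i, j)) = (map_mat h W ^\<^sub>m k) $$ (i, j)" if "i < n" "j < n" for i j k
    using that carrier_matD[OF pow_carrier_mat[OF W, of k]] by (simp flip: mat_hom_pow[OF W])
  then show ?thesis
    by (intro eq_matI) (auto simp: krylov_def hom_distribs)
qed

definition neg_shift :: "nat \<Rightarrow> 'a::comm_ring_1 mat" where
  "neg_shift n = mat n n (\<lambda>(i, j). if i = Suc j then - 1 else 0)"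

lemma neg_shift_carrier [simp]: "neg_shift n \<in> carrier_mat n n"
  by (simp add: neg_shift_def)

text \<open>The last unit row vector times the k-th power is (-1)^k times the unit vector k places
  to the left, and the signs in \<open>krylov\<close> cancel these. This exhibits a W whose Krylov
  determinant is 1.\<close>

lemma krylov_neg_shift: "krylov n (neg_shift n :: 'a::comm_ring_1 mat) = 1\<^sub>m n"
proof -
  let ?N = "neg_shift n :: 'a mat"
  have N: "?N \<in> carrier_mat n n" by (simp add: neg_shift_def)
  have pow: "(?N ^\<^sub>m k) $$ (n - Suc 0, j) = (if j + k = n - Suc 0 then (- 1) ^ k else 0)" if "j < n" for j k
    using that
  proof (induction k arbitrary: j)
    case 0
    then show ?case using N carrier_matD[OF N] by auto
  next
    case (Suc k)
    have "(?N ^\<^sub>m Suc k) $$ (n - Suc 0, j) = (\<Sum>l<n. (?N ^\<^sub>m k) $$ (n - Suc 0, l) * ?N $$ (l, j))"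
      using Suc.prems carrier_matD[OF pow_carrier_mat[OF N, of k]] carrier_matD[OF N] by (simp add: scalar_prod_def atLeast0LessThan)
    also have "\<dots> = (\<Sum>l<n. if l = Suc j then - (?N ^\<^sub>m k) $$ (n - Suc 0, l) else 0)"
      using Suc.prems by (intro sum.cong refl) (auto simp: neg_shift_def)
    also have "\<dots> = (if j + Suc k = n - Suc 0 then (- 1) ^ Suc k else 0)"
      using Suc.prems by (auto simp: sum.delta Suc.IH)
    finally show ?case .
  qed
  show ?thesis
    by (rule eq_matI) (auto simp: krylov_def pow simp flip: power_mult_distrib)
qed

text \<open>With A the Krylov matrix and D = \<open>scale_first n \<delta>\<close>, the pair S = D A
  D^-1, T = A^-1 fixes D and sends D W to D (A W A^-1). The determinants are det A and 1 / det A.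
  Left multiplication by D changes only the first row, hence keeps the subdiagonal shape of A W
  A^-1.\<close>

lemma pencil_normal_form:
  fixes W :: "'k::field mat"
  assumes n: "n \<ge> 1" and W: "W \<in> carrier_mat n n" and "\<delta> \<noteq> 0" and "det (krylov n W) \<noteq> 0"
  obtains c S T where "S \<in> carrier_mat n n" "T \<in> carrier_mat n n" "det S * det T = 1"
    "S * scale_first n \<delta> * T = section_X n c" "S * (scale_first n \<delta> * W) * T = section_Y n c"
proof -
  let ?A = "krylov n W" and ?D = "scale_first n \<delta>" and ?D' = "scale_first n (1 / \<delta>)"
  obtain B where B: "B \<in> carrier_mat n n" "?A * B = 1\<^sub>m n" "B * ?A = 1\<^sub>m n"
    using invertible_obtain[OF krylov_carrier assms(4)] .
  let ?S = "?D * ?A * ?D'"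
  define M where "M = ?A * W * B"
  have M: "M \<in> carrier_mat n n" using W B by (simp add: M_def)
  have D: "?D' * ?D = 1\<^sub>m n"
    using \<open>\<delta> \<noteq> 0\<close> by (intro scale_first_inverse) auto
  have M_row: "M $$ (Suc i, j) = (if i = j then - 1 else 0)" if "Suc i < n" "j < n" for i j
  proof -
    have "M $$ (Suc i, j) = (\<Sum>l<n. (?A * W) $$ (Suc i, l) * B $$ (l, j))"
      using that W B carrier_matD[OF krylov_carrier[of n W]]
      unfolding M_def by (subst index_mult_mat) (auto simp: scalar_prod_def atLeast0LessThan)
    also have "\<dots> = (\<Sum>l<n. - (?A $$ (i, l) * B $$ (l, j)))"
      using that krylov_mult[OF W] by (intro sum.cong refl) auto
    also have "\<dots> = - (\<Sum>l<n. ?A $$ (i, l) * B $$ (l, j))"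
      by (rule sum_negf)
    also have "(\<Sum>l<n. ?A $$ (i, l) * B $$ (l, j)) = (?A * B) $$ (i, j)"
      using that B(1) carrier_matD[OF krylov_carrier[of n W]]
      by (subst index_mult_mat) (auto simp: scalar_prod_def atLeast0LessThan)
    also have "(?A * B) $$ (i, j) = (if i = j then 1 else 0)"
      using that by (simp add: B(2))
    finally show ?thesis by simp
  qed
  \<comment> \<open>The section lists the first row from c (n - 1) down to c 0, whence the reversed
    index; c n is the corner entry of D.\<close>
  define c where "c = (\<lambda>k. if k = n then \<delta> else \<delta> * M $$ (0, n - 1 - k))"
  show ?thesis
  proof
    show "?S \<in> carrier_mat n n" "B \<in> carrier_mat n n"
      using B by auto
    have "det ?A * det B = 1"
      using det_mult[OF krylov_carrier B(1), of W] B(2) by simp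
    then show "det ?S * det B = 1"
      using B(1) n \<open>\<delta> \<noteq> 0\<close> by (simp add: det_mult[of _ n] det_scale_first)
    have "?S * ?D * B = ?D * (?A * (?D' * ?D) * B)"
      using B(1) by (simp add: assoc_mult_mat[of _ n n _ n _ n])
    also have "\<dots> = ?D"
      using B D by (simp add: right_mult_one_mat[of _ n n])
    also have "?D = section_X n c"
      by (rule eq_matI) (auto simp: scale_first_def section_X_def c_def)
    finally show "?S * ?D * B = section_X n c" .
    have "?S * (?D * W) * B = ?D * (?A * (?D' * ?D) * W * B)"
      using B(1) W by (simp add: assoc_mult_mat[of _ n n _ n _ n])
    also have "?A * (?D' * ?D) * W * B = M"
      unfolding D M_def by (simp add: right_mult_one_mat[of _ n n])
    also have "?D * M = section_Y n c"
    proof (rule eq_matI)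
      fix i j assume "i < dim_row (section_Y n c)" "j < dim_col (section_Y n c)"
      then have ij: "i < n" "j < n" by (auto simp: section_Y_def)
      then show "(?D * M) $$ (i, j) = section_Y n c $$ (i, j)"
        using M M_row[of "i - 1" j] n
        by (cases i) (auto simp: scale_first_mult_left section_Y_def c_def)
    qed (use M in \<open>auto simp: section_Y_def scale_first_def\<close>)
    finally show "?S * (?D * W) * B = section_Y n c" .
  qed
qed

section \<open>Extending the vanishing of a polynomial along lines, and generation\<close>

text \<open>Along the line from x (t = 0) to y (t = 1) the values of p form a polynomial q in t. Its
  product with d vanishes everywhere, so q = 0 and in particular q(0) = 0. This is the form in which
  Zariski density is used.\<close>

lemma eval_eq_0_by_line:
  fixes x y :: "'v \<Rightarrow> 'k::field"
  assumes inf: "infinite (UNIV :: 'k set)" and "d \<noteq> 0"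
    and z: "\<And>t. poly d t \<noteq> 0 \<Longrightarrow> eval (\<lambda>v. x v + t * (y v - x v)) p = 0"
  shows "eval x p = 0"
proof -
  let ?q = "insertion (\<lambda>c. [:c:]) (\<lambda>v. [:x v, y v - x v:]) p"
  have q: "poly ?q t = eval (\<lambda>v. x v + t * (y v - x v)) p" for t
    by (simp add: poly_insertion_const_poly)
  have "poly (d * ?q) t = 0" for t
    using z[of t] by (cases "poly d t = 0") (auto simp: q)
  then have "d * ?q = 0"
    by (rule poly_eq_0_of_zeros[OF inf])
  then have "poly ?q 0 = 0"
    using \<open>d \<noteq> 0\<close> by simp
  then show ?thesis by (simp add: q)
qed

definition f_subst :: "nat \<Rightarrow> (nat, 'k::field) mpoly \<Rightarrow> (tvar, 'k) mpoly" where
  "f_subst n = insertion Const (\<lambda>k. f_inv n k (n - k))"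

text \<open>\<open>Var k\<close> stands for the coefficient c k, so the restriction is a polynomial
  in n + 1 variables and not just a function on the section.\<close>

definition section_restrict :: "nat \<Rightarrow> (tvar, 'k::field) mpoly \<Rightarrow> (nat, 'k) mpoly" where
  "section_restrict n = insertion Const (pencil_point (section_X n Var) (section_Y n Var))"

lemma section_restrict_in_poly_ring:
  assumes "p \<in> poly_ring (tvars n)"
  shows "section_restrict n p \<in> poly_ring {..n}"
proof -
  note P = is_subalgebra_poly_ring[of "{..n}"]
  have "Var k \<in> poly_ring {..n}" if "k \<le> n" for k
    using that by (auto simp: Var_def poly_ring_def)
  moreover have "0 \<in> poly_ring {..n}" "1 \<in> poly_ring {..n}" "- 1 \<in> poly_ring {..n}"
    using subalgebra_zero[OF P] subalgebra_one[OF P]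
      subalgebra_diff[OF P subalgebra_zero[OF P] subalgebra_one[OF P]] by auto
  ultimately have "pencil_point (section_X n Var) (section_Y n Var) v \<in> poly_ring {..n}" if "v \<in> tvars n" for v
    using that by (elim tvarsE) (auto simp: pencil_point_def section_X_def section_Y_def)
  then show ?thesis
    unfolding section_restrict_def by (intro subalgebra_insertion[OF P assms])
qed

lemma eval_section_restrict:
  assumes "p \<in> poly_ring (tvars n)"
  shows "eval c (section_restrict n p) = eval (pencil_point (section_X n c) (section_Y n c)) p"
proof -
  interpret comm_ring_hom "eval c" by (rule comm_ring_hom_eval)
  show ?thesis
    unfolding section_restrict_def eval_insertion_Const
  proof (rule insertion_cong[OF assms])
    fix v assume "v \<in> tvars n"
    then show "eval c (pencil_point (section_X n Var) (section_Y n Var) v) =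
        pencil_point (section_X n c) (section_Y n c) v"
      by (elim tvarsE) (auto simp: pencil_point_def section_X_def section_Y_def hom_uminus)
  qed
qed

lemma f_subst_in_invariant_ring:
  assumes "infinite (UNIV :: 'k::field set)" "h \<in> poly_ring {..n}"
  shows "(f_subst n h :: (tvar, 'k) mpoly) \<in> invariant_ring n"
  unfolding f_subst_def using assms f_inv_in_invariant_ring
  by (intro subalgebra_insertion[OF is_subalgebra_invariant_ring]) auto

theorem invariant_eq_f_subst:
  fixes p :: "(tvar, 'k::field) mpoly"
  assumes inf: "infinite (UNIV :: 'k set)" and n: "n \<ge> 1" and p: "p \<in> invariant_ring n"
  shows "p = f_subst n (section_restrict n p)"
proof -
  let ?h = "section_restrict n p"
  \<comment> \<open>The difference is an invariant as well. It vanishes on the section because the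
    f's take the values c k there; the claims below enlarge the set of pencils on which it is known
    to vanish.\<close>
  define g where "g = p - f_subst n ?h"
  have p': "p \<in> poly_ring (tvars n)"
    using p by (simp add: invariant_ring_def)
  have h: "?h \<in> poly_ring {..n}"
    by (rule section_restrict_in_poly_ring[OF p'])
  have g: "g \<in> invariant_ring n"
    unfolding g_def by (intro subalgebra_diff[OF is_subalgebra_invariant_ring p f_subst_in_invariant_ring[OF inf h]])
  then have g': "g \<in> poly_ring (tvars n)"
    by (simp add: invariant_ring_def)
  have g_eval: "eval x g = eval x p - eval (\<lambda>k. eval x (f_inv n k (n - k))) ?h" for x
  proof -
    interpret comm_ring_hom "eval x" by (rule comm_ring_hom_eval)
    show ?thesis by (simp add: g_def hom_minus f_subst_def eval_insertion_Const)
  qed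

  \<comment> \<open>These pencils are moved into the section by pairs with reciprocal
    determinants.\<close>
  have cyclic: "eval (pencil_point (scale_first n \<delta>) (scale_first n \<delta> * W)) g = 0"
    if \<delta>: "\<delta> \<noteq> 0" and W: "W \<in> carrier_mat n n" and K: "det (krylov n W) \<noteq> 0" for \<delta> W
  proof -
    let ?D = "scale_first n \<delta>"
    obtain c S T where ST: "S \<in> carrier_mat n n" "T \<in> carrier_mat n n" "det S * det T = 1"
      and c: "S * ?D * T = section_X n c" "S * (?D * W) * T = section_Y n c"
      using pencil_normal_form[OF n W \<delta> K] by blast
    have D: "?D \<in> carrier_mat n n" "?D * W \<in> carrier_mat n n"
      using W by auto
    have "eval (pencil_point ?D (?D * W)) g = eval (pencil_point (section_X n c) (section_Y n c)) g"
      using invariant_sandwich[OF inf n g D ST] unfolding c by simp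
    moreover have "eval (\<lambda>k. f_inv_at n (section_X n c) (section_Y n c) k) ?h = eval c ?h"
      using f_inv_at_section[OF inf n] by (intro insertion_cong[OF h]) auto
    ultimately show ?thesis
      by (simp add: g_eval eval_section_restrict[OF p'])
  qed

  \<comment> \<open>D stays fixed and only the second matrix moves, on the line from D W to D N with
    N = \<open>neg_shift n\<close>. The Krylov determinant along it is a nonzero polynomial, being 1
    at t = 1.\<close>
  have diagonal: "eval (pencil_point (scale_first n \<delta>) (scale_first n \<delta> * W)) g = 0"
    if \<delta>: "\<delta> \<noteq> 0" and W: "W \<in> carrier_mat n n" for \<delta> W
  proof -
    let ?D = "scale_first n \<delta>"
    let ?L = "mat n n (\<lambda>(i, j). [:W $$ (i, j), neg_shift n $$ (i, j) - W $$ (i, j):])"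
    let ?d = "det (krylov n ?L)"
    have d: "poly ?d t = det (krylov n (map_mat (\<lambda>q. poly q t) ?L))" for t
    proof -
      interpret comm_ring_hom "\<lambda>q. poly q t" by (rule comm_ring_hom_poly)
      show ?thesis
        by (simp flip: hom_det add: hom_krylov[OF comm_ring_hom_poly])
    qed
    have "map_mat (\<lambda>q. poly q 1) ?L = neg_shift n"
      by (rule eq_matI) (auto simp: neg_shift_def)
    then have "poly ?d 1 = 1"
      by (simp add: d krylov_neg_shift)
    then have "?d \<noteq> 0" by auto
    then show ?thesis
    proof (rule eval_eq_0_by_line[OF inf, where y = "pencil_point ?D (?D * neg_shift n)"])
      fix t assume t: "poly ?d t \<noteq> 0"
      let ?W = "map_mat (\<lambda>q. poly q t) ?L"
      let ?x = "pencil_point ?D (?D * W)" and ?y = "pencil_point ?D (?D * neg_shift n)"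
      have "eval (\<lambda>v. ?x v + t * (?y v - ?x v)) g = eval (pencil_point ?D (?D * ?W)) g"
      proof (rule insertion_cong[OF g'])
        fix v assume "v \<in> tvars n"
        then obtain i j k where v: "v = (i, j, k)" "i < n" "j < n" "k = 0 \<or> k = 1"
          by (rule tvarsE)
        moreover have "?W \<in> carrier_mat n n"
          by auto
        ultimately show "?x v + t * (?y v - ?x v) = pencil_point ?D (?D * ?W) v"
          using W by (auto simp: pencil_point_def scale_first_mult_left algebra_simps)
      qed
      then show "eval (\<lambda>v. ?x v + t * (?y v - ?x v)) g = 0"
        using cyclic[OF \<delta>, of ?W] t by (simp add: d)
    qed
  qed

  \<comment> \<open>For D = diag(det X, 1, ..., 1) the matrix D X^-1 lies in SL(n), so left
    multiplication alone reduces to the previous case.\<close>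
  have invertible: "eval (pencil_point X Y) g = 0"
    if X: "X \<in> carrier_mat n n" and Y: "Y \<in> carrier_mat n n" and "det X \<noteq> 0" for X Y
  proof -
    let ?D = "scale_first n (det X)"
    obtain B where B: "B \<in> carrier_mat n n" "X * B = 1\<^sub>m n" "B * X = 1\<^sub>m n"
      using invertible_obtain[OF X \<open>det X \<noteq> 0\<close>] .
    have "det (?D * B) = det X * det B"
      using B n by (simp add: det_mult[of _ n] det_scale_first)
    also have "\<dots> = 1"
      using det_mult[OF X B(1)] B(2) by simp
    finally have SL: "?D * B \<in> SL n" "1\<^sub>m n \<in> SL n"
      using B by (auto simp: SL_def)
    have "?D * B * X * 1\<^sub>m n = ?D * (B * X)" "?D * B * Y * 1\<^sub>m n = ?D * (B * Y)"
      using B(1) X Y by (simp_all add: assoc_mult_mat[of _ n n _ n _ n] right_mult_one_mat[of _ n n])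
    then have "eval (pencil_point X Y) g = eval (pencil_point ?D (?D * (B * Y))) g"
      using invariant_ringD[OF g SL X Y] B by (simp add: right_mult_one_mat[of _ n n])
    also have "\<dots> = 0"
      using B Y \<open>det X \<noteq> 0\<close> by (intro diagonal) auto
    finally show ?thesis .
  qed

  have "eval x g = 0" for x
  proof -
    \<comment> \<open>The line ends, at t = 1, in the pencil of two identity matrices; the
      determinant of the first slice along the line is 1 there.\<close>
    let ?y = "\<lambda>(i, j, k :: nat). if i = j then 1 else 0 :: 'k"
    let ?L = "mat n n (\<lambda>(i, j). [:x (i, j, 0), ?y (i, j, 0) - x (i, j, 0):])"
    have d: "poly (det ?L) t = det (map_mat (\<lambda>q. poly q t) ?L)" for t
    proof -
      interpret comm_ring_hom "\<lambda>q. poly q t" by (rule comm_ring_hom_poly)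
      show ?thesis by simp
    qed
    have "map_mat (\<lambda>q. poly q 1) ?L = 1\<^sub>m n"
      by (rule eq_matI) auto
    then have "poly (det ?L) 1 = 1"
      by (simp only: d det_one)
    then have "det ?L \<noteq> 0" by auto
    then show ?thesis
    proof (rule eval_eq_0_by_line[OF inf, where y = ?y])
      fix t assume t: "poly (det ?L) t \<noteq> 0"
      let ?x = "\<lambda>v. x v + t * (?y v - x v)"
      have "slice_at n 0 ?x = map_mat (\<lambda>q. poly q t) ?L"
        by (rule eq_matI) (auto simp: slice_at_def)
      then have "det (slice_at n 0 ?x) \<noteq> 0"
        using t by (simp only: d not_False_eq_True)
      then have "eval (pencil_point (slice_at n 0 ?x) (slice_at n 1 ?x)) g = 0"
        by (intro invertible) simp_all
      then show "eval ?x g = 0"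
        by (simp only: eval_pencil_point_slice_at[OF g'])
    qed
  qed
  then have "g = 0"
    by (rule eval_eq_0_imp_eq_0[OF inf])
  then show ?thesis by (simp add: g_def)
qed

section \<open>Algebraic independence and the isomorphism\<close>

text \<open>Expresses the algebraic independence of the f's: on the section they take arbitrary
  prescribed values, and over an infinite field these values determine h.\<close>

lemma section_restrict_f_subst:
  fixes h :: "(nat, 'k::field) mpoly"
  assumes inf: "infinite (UNIV :: 'k set)" and n: "n \<ge> 1" and h: "h \<in> poly_ring {..n}"
  shows "section_restrict n (f_subst n h) = h"
proof (rule eval_eq_imp_eq[OF inf])
  fix c
  have "f_subst n h \<in> poly_ring (tvars n)"
    using f_subst_in_invariant_ring[OF inf h] by (simp add: invariant_ring_def)
  then have "eval c (section_restrict n (f_subst n h)) =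
      eval (\<lambda>k. f_inv_at n (section_X n c) (section_Y n c) k) h"
    by (simp add: eval_section_restrict f_subst_def eval_insertion_Const)
  also have "\<dots> = eval c h"
    using f_inv_at_section[OF inf n] by (intro insertion_cong[OF h]) auto
  finally show "eval c (section_restrict n (f_subst n h)) = eval c h" .
qed

lemma invariant_ring_isomorphic:
  assumes inf: "infinite (UNIV :: 'k::field set)" and n: "n \<ge> 1"
  shows "algebra_isomorphic (invariant_ring n :: (tvar, 'k) mpoly set) (poly_ring {..<n + 1})"
proof -
  have "{..<n + 1} = {..n}" by auto
  moreover have "bij_betw (section_restrict n) (invariant_ring n :: (tvar, 'k) mpoly set) (poly_ring {..n})"
  proof (rule bij_betw_byWitness[where f' = "f_subst n"])
    show "\<forall>p\<in>invariant_ring n. f_subst n (section_restrict n p) = (p :: (tvar, 'k) mpoly)"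
      using invariant_eq_f_subst[OF inf n] by simp
    show "\<forall>h\<in>poly_ring {..n}. section_restrict n (f_subst n h) = (h :: (nat, 'k) mpoly)"
      using section_restrict_f_subst[OF inf n] by simp
    show "section_restrict n ` (invariant_ring n :: (tvar, 'k) mpoly set) \<subseteq> poly_ring {..n}"
      using section_restrict_in_poly_ring by (auto simp: invariant_ring_def)
    show "f_subst n ` poly_ring {..n} \<subseteq> (invariant_ring n :: (tvar, 'k) mpoly set)"
      using f_subst_in_invariant_ring[OF inf] by auto
  qed
  ultimately have "algebra_iso (invariant_ring n :: (tvar, 'k) mpoly set) (poly_ring {..<n + 1}) (section_restrict n)"
    by (simp add: algebra_iso_def section_restrict_def insertion_Const[OF comm_ring_hom_Const]
        insertion_add[OF comm_ring_hom_Const] insertion_mult[OF comm_ring_hom_Const])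
  then show ?thesis
    unfolding algebra_isomorphic_def by blast
qed

lemma f_subst_in_algebra_gen:
  assumes "h \<in> poly_ring {..n}"
  shows "f_subst n h \<in> algebra_gen {f_inv n k (n - k) | k. k \<le> n}"
proof -
  have "f_inv n k (n - k) \<in> algebra_gen {f_inv n k (n - k) | k. k \<le> n}" if "k \<in> {..n}" for k
    by (rule subsetD[OF algebra_gen_superset]) (use that in auto)
  then show ?thesis
    unfolding f_subst_def by (rule subalgebra_insertion[OF is_subalgebra_algebra_gen assms])
qed

lemma invariant_ring_eq_algebra_gen:
  assumes inf: "infinite (UNIV :: 'k::field set)" and n: "n \<ge> 1"
  shows "(invariant_ring n :: (tvar, 'k) mpoly set) = algebra_gen {f_inv n k (n - k) | k. k \<le> n}"
proof
  show "invariant_ring n \<subseteq> algebra_gen {f_inv n k (n - k) :: (tvar, 'k) mpoly | k. k \<le> n}"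
  proof
    fix p :: "(tvar, 'k) mpoly" assume p: "p \<in> invariant_ring n"
    then have "section_restrict n p \<in> poly_ring {..n}"
      by (intro section_restrict_in_poly_ring) (simp add: invariant_ring_def)
    then show "p \<in> algebra_gen {f_inv n k (n - k) | k. k \<le> n}"
      using f_subst_in_algebra_gen[of "section_restrict n p" n] invariant_eq_f_subst[OF inf n p] by simp
  qed
  show "algebra_gen {f_inv n k (n - k) | k. k \<le> n} \<subseteq> (invariant_ring n :: (tvar, 'k) mpoly set)"
    using f_inv_in_invariant_ring[OF inf]
    by (intro algebra_gen_minimal is_subalgebra_invariant_ring) auto
qed

section \<open>Leading monomials\<close>

lemma tvar_greater_trans: "tvar_greater u v \<Longrightarrow> tvar_greater v w \<Longrightarrow> tvar_greater u w"
  by (auto simp: tvar_greater_def split: prod.splits)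

lemma tvar_greater_total: "u = v \<or> tvar_greater u v \<or> tvar_greater v u"
  by (auto simp: tvar_greater_def split: prod.splits)

text \<open>The triples (k, j, i) are compared lexicographically, and larger variables precede
  smaller ones, so every nonempty set of variables has a greatest element. This gives the first
  variable in which two monomials differ.\<close>

lemma wf_tvar_greater: "wf {(u, v). tvar_greater u v}"
proof (rule wf_subset)
  show "wf (inv_image (less_than <*lex*> less_than <*lex*> less_than) (\<lambda>(i, j, k). (k, j, i)))"
    by (intro wf_inv_image wf_lex_prod wf_less_than)
qed (auto simp: tvar_greater_def inv_image_def)

lemma deglex_less_irrefl: "\<not> deglex_less s s"
  by (simp add: deglex_less_def)

lemma deglex_less_trans:
  assumes "deglex_less s t" "deglex_less t r"
  shows "deglex_less s r"
proof (cases "mdeg s < mdeg t \<or> mdeg t < mdeg r")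
  case True
  then show ?thesis using assms by (auto simp: deglex_less_def)
next
  case False
  then have deg: "mdeg s = mdeg t" "mdeg t = mdeg r"
    using assms by (auto simp: deglex_less_def)
  obtain v where v: "lookup s v < lookup t v" "\<And>u. tvar_greater u v \<Longrightarrow> lookup s u = lookup t u"
    using assms(1) deg by (auto simp: deglex_less_def)
  obtain w where w: "lookup t w < lookup r w" "\<And>u. tvar_greater u w \<Longrightarrow> lookup t u = lookup r u"
    using assms(2) deg by (auto simp: deglex_less_def)
  \<comment> \<open>The larger of the two deciding variables decides between s and r.\<close>
  consider "v = w" | "tvar_greater v w" | "tvar_greater w v"
    using tvar_greater_total by blast
  then have "\<exists>x. lookup s x < lookup r x \<and> (\<forall>u. tvar_greater u x \<longrightarrow> lookup s u = lookup r u)"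
  proof cases
    case 1
    then show ?thesis using v w by (intro exI[of _ v]) auto
  next
    case 2
    then show ?thesis using v w tvar_greater_trans by (intro exI[of _ v]) (metis (no_types))
  next
    case 3
    then show ?thesis using v w tvar_greater_trans by (intro exI[of _ w]) (metis (no_types))
  qed
  then show ?thesis using deg by (simp add: deglex_less_def)
qed

lemma deglex_less_total:
  assumes "s \<noteq> t"
  shows "deglex_less s t \<or> deglex_less t s"
proof (cases "mdeg s = mdeg t")
  case True
  let ?D = "{v. lookup s v \<noteq> lookup t v}"
  obtain x where "lookup s x \<noteq> lookup t x"
    using assms by (meson poly_mapping_eqI)
  then have "x \<in> ?D" by simp
  then obtain v where "v \<in> ?D" and min: "\<And>u. (u, v) \<in> {(u, v). tvar_greater u v} \<Longrightarrow> u \<notin> ?D"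
    by (rule wfE_min[OF wf_tvar_greater]) blast
  then have "lookup s v < lookup t v \<or> lookup t v < lookup s v"
    and "tvar_greater u v \<Longrightarrow> lookup s u = lookup t u" for u
    by auto
  then show ?thesis
    using True unfolding deglex_less_def by metis
qed (auto simp: deglex_less_def)

lemma mdeg_add: "mdeg (s + t) = mdeg s + mdeg t"
  unfolding mdeg_def by (rule setsum_keys_plus_distrib) auto

lemma deglex_less_add: "deglex_less s t \<Longrightarrow> deglex_less (s + r) (t + r)"
  by (auto simp: deglex_less_def mdeg_add lookup_add)

section \<open>Leading exponents of products and sums\<close>

definition all_below :: "(tvar \<Rightarrow>\<^sub>0 nat) \<Rightarrow> (tvar, 'k::field) mpoly \<Rightarrow> bool" where
  "all_below a p \<longleftrightarrow> (\<forall>s\<in>keys p. deglex_less s a)"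

text \<open>A relation in place of the definite description in \<open>lm\<close>: such
  decompositions can be multiplied and added, and \<open>lm_eq\<close> translates back.\<close>

definition is_lead :: "(tvar, 'k::field) mpoly \<Rightarrow> (tvar \<Rightarrow>\<^sub>0 nat) \<Rightarrow> bool" where
  "is_lead p a \<longleftrightarrow> (\<exists>c q. c \<noteq> 0 \<and> p = single a c + q \<and> all_below a q)"

lemma all_below_add: "all_below a p \<Longrightarrow> all_below a q \<Longrightarrow> all_below a (p + q)"
  using Poly_Mapping.keys_add[of p q] by (auto simp: all_below_def)

lemma all_below_sum: "(\<And>i. i \<in> I \<Longrightarrow> all_below a (f i)) \<Longrightarrow> all_below a (sum f I)"
  by (induction I rule: infinite_finite_induct) (auto simp: all_below_add, simp_all add: all_below_def)

text \<open>Strict on one factor and weak on the other, which fits the cross terms of a product,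
  where only one factor has lost its leading term.\<close>

lemma all_below_mult:
  assumes "all_below a p" "\<And>s. s \<in> keys q \<Longrightarrow> s = b \<or> deglex_less s b"
  shows "all_below (a + b) (p * q)"
  unfolding all_below_def
proof
  fix s assume "s \<in> keys (p * q)"
  then obtain x y where xy: "s = x + y" "x \<in> keys p" "y \<in> keys q"
    using keys_mult[of p q] by auto
  then have 1: "deglex_less (x + y) (a + y)"
    using assms(1) by (auto simp: all_below_def intro: deglex_less_add)
  have "y = b \<or> deglex_less (y + a) (b + a)"
    using assms(2)[OF xy(3)] deglex_less_add by blast
  then show "deglex_less s (a + b)"
    using 1 deglex_less_trans xy(1) by (auto simp: add.commute)
qed

lemma is_lead_keys:
  assumes "is_lead p a"
  shows "a \<in> keys p" "s \<in> keys p \<Longrightarrow> s = a \<or> deglex_less s a"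
proof -
  obtain c q where cq: "c \<noteq> 0" "p = single a c + q" "all_below a q"
    using assms by (auto simp: is_lead_def)
  then have "lookup q a = 0"
    using deglex_less_irrefl unfolding all_below_def by (meson in_keys_iff)
  then show "a \<in> keys p"
    using cq by (simp add: in_keys_iff lookup_add)
  show "s = a \<or> deglex_less s a" if "s \<in> keys p"
    using that cq Poly_Mapping.keys_add[of "single a c" q] by (auto simp: all_below_def)
qed

lemma is_lead_nonzero: "is_lead p a \<Longrightarrow> p \<noteq> 0"
  using is_lead_keys(1) by fastforce

lemma lm_eq: "is_lead p a \<Longrightarrow> lm p = single a 1"
proof -
  assume p: "is_lead p a"
  have "(THE m. m \<in> keys p \<and> (\<forall>s\<in>keys p. s \<noteq> m \<longrightarrow> deglex_less s m)) = a"
  proof (rule the_equality)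
    show "a \<in> keys p \<and> (\<forall>s\<in>keys p. s \<noteq> a \<longrightarrow> deglex_less s a)"
      using is_lead_keys[OF p] by auto
  next
    fix m assume m: "m \<in> keys p \<and> (\<forall>s\<in>keys p. s \<noteq> m \<longrightarrow> deglex_less s m)"
    show "m = a"
    proof (rule ccontr)
      assume "m \<noteq> a"
      then have "deglex_less m a" "deglex_less a m"
        using m is_lead_keys[OF p] by auto
      then show False
        using deglex_less_trans deglex_less_irrefl by blast
    qed
  qed
  then show ?thesis
    unfolding lm_def by simp
qed

lemma is_lead_Const: "c \<noteq> 0 \<Longrightarrow> is_lead (Const c) 0"
  unfolding is_lead_def Const_def
  by (rule exI[of _ c], rule exI[of _ 0]) (simp add: all_below_def)

lemma is_lead_one: "is_lead 1 0"
  using is_lead_Const[of 1] by (simp add: Const_def)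

lemma is_lead_mult:
  assumes p: "is_lead p a" and q: "is_lead q b"
  shows "is_lead (p * q) (a + b)"
proof -
  obtain c p' where p': "c \<noteq> 0" "p = single a c + p'" "all_below a p'"
    using p by (auto simp: is_lead_def)
  obtain d q' where q': "d \<noteq> 0" "q = single b d + q'" "all_below b q'"
    using q by (auto simp: is_lead_def)
  have "p * q = single (a + b) (c * d) + (q' * single a c + p' * q)"
    by (subst p'(2), subst distrib_right, subst (1) q'(2)) (simp add: algebra_simps mult_single)
  moreover have "all_below (b + a) (q' * single a c)"
    by (rule all_below_mult[OF q'(3)]) (simp split: if_splits)
  then have "all_below (a + b) (q' * single a c)"
    by (simp only: add.commute)
  moreover have "all_below (a + b) (p' * q)"
    using is_lead_keys(2)[OF q] by (intro all_below_mult[OF p'(3)])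
  ultimately show ?thesis
    using p'(1) q'(1) unfolding is_lead_def
    by (intro exI[of _ "c * d"] exI[of _ "q' * single a c + p' * q"]) (auto intro: all_below_add)
qed

lemma is_lead_power: "is_lead p a \<Longrightarrow> is_lead (p ^ e) (\<Sum>i<e. a)"
proof (induction e)
  case (Suc e)
  then show ?case
    using is_lead_mult[of "p ^ e" "\<Sum>i<e. a" p a] by (simp only: power_Suc2 sum.lessThan_Suc)
qed (simp add: is_lead_one)

lemma is_lead_prod: "(\<And>i. i \<in> I \<Longrightarrow> is_lead (f i) (a i)) \<Longrightarrow> is_lead (prod f I) (sum a I)"
  by (induction I rule: infinite_finite_induct) (auto intro: is_lead_one is_lead_mult)

lemma is_lead_add_below:
  "is_lead p a \<Longrightarrow> all_below a q \<Longrightarrow> is_lead (p + q) a"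
proof -
  assume "is_lead p a" and q: "all_below a q"
  then obtain c p' where "c \<noteq> 0" "p = single a c + p'" "all_below a p'"
    by (auto simp: is_lead_def)
  then show "is_lead (p + q) a"
    unfolding is_lead_def using q
    by (intro exI[of _ c] exI[of _ "p' + q"]) (simp add: add.assoc all_below_add)
qed

text \<open>Distinct leading exponents cannot cancel, so the largest of them is the leading exponent
  of the sum; the induction compares the new summand with the previous winner.\<close>

lemma is_lead_sum:
  fixes f :: "'i \<Rightarrow> (tvar, 'k::field) mpoly"
  assumes "finite I" "I \<noteq> {}" "inj_on a I" "\<And>i. i \<in> I \<Longrightarrow> is_lead (f i) (a i)"
  shows "\<exists>i\<in>I. is_lead (sum f I) (a i)"
  using assms
proof (induction I rule: finite_ne_induct)
  case (insert j I)
  then obtain i where i: "i \<in> I" "is_lead (sum f I) (a i)" by auto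
  have j: "is_lead (f j) (a j)" using insert.prems by simp
  have below: "all_below y q" if "is_lead q x" "deglex_less x y" for q :: "(tvar, 'k) mpoly" and x y
    using is_lead_keys(2)[OF that(1)] that(2) deglex_less_trans by (auto simp: all_below_def)
  have "a i \<noteq> a j"
    using insert.prems(1) insert.hyps i by (auto simp: inj_on_def)
  then consider "deglex_less (a i) (a j)" | "deglex_less (a j) (a i)"
    using deglex_less_total by blast
  then show ?case
  proof cases
    case 1
    then have "is_lead (f j + sum f I) (a j)"
      using i j below by (intro is_lead_add_below)
    then show ?thesis using insert.hyps by auto
  next
    case 2
    then have "is_lead (sum f I + f j) (a i)"
      using i j below by (intro is_lead_add_below)
    then show ?thesis using insert.hyps i by (auto simp: add.commute)
  qed
qed auto

section \<open>Leading monomials of the f's and of their products\<close>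

abbreviation f_lead :: "nat \<Rightarrow> nat \<Rightarrow> tvar \<Rightarrow>\<^sub>0 nat" where
  "f_lead n k \<equiv> det_monom n id {..<k}"

text \<open>Both monomials have degree n and exponents 0 or 1, so the comparison is decided at the
  first diagonal variable that the competitor lacks. This is (j, j, 0) if some column j < |S|
  violates \<open>j \<in> S\<close> or \<open>\<pi> j = j\<close>; otherwise S is the initial
  segment, and (j, j, 1) decides for the first j moved by \<pi>.\<close>

lemma det_monom_less_f_lead:
  assumes \<pi>: "\<pi> permutes {0..<n}" and S: "S \<subseteq> {..<n}" and neq: "(\<pi>, S) \<noteq> (id, {..<card S})"
  shows "deglex_less (det_monom n \<pi> S) (f_lead n (card S))"
proof -
  let ?k = "card S"
  have k: "?k \<le> n"
    using card_mono[OF _ S] by simp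
  have inj: "\<pi> i = \<pi> j \<Longrightarrow> i = j" for i j
    using permutes_inj[OF \<pi>] by (auto dest: injD)
  have "\<exists>v. lookup (det_monom n \<pi> S) v < lookup (f_lead n ?k) v \<and>
    (\<forall>u. tvar_greater u v \<longrightarrow> lookup (det_monom n \<pi> S) u = lookup (f_lead n ?k) u)"
  proof (cases "\<exists>j<?k. \<not> (j \<in> S \<and> \<pi> j = j)")
    case True
    then obtain j where j: "j < ?k" "\<not> (j \<in> S \<and> \<pi> j = j)"
      and min: "\<And>l. l < j \<Longrightarrow> l \<in> S \<and> \<pi> l = l"
      using exists_least_iff[of "\<lambda>j. j < ?k \<and> \<not> (j \<in> S \<and> \<pi> j = j)"] by (metis order.strict_trans)
    have "lookup (det_monom n \<pi> S) u = lookup (f_lead n ?k) u" if u: "tvar_greater u (j, j, 0)" for u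
    proof -
      obtain i l where u': "u = (i, l, 0)" "l < j \<or> l = j \<and> i < j"
        using u by (cases u) (auto simp: tvar_greater_def)
      show ?thesis
      proof (cases "l < j")
        case True
        then show ?thesis using u' min[OF True] j by (auto simp: lookup_det_monom)
      next
        case False
        then have "l = j" "i < j" using u' by auto
        \<comment> \<open>Row i is already occupied by column i, since \<pi> fixes every index below
          j; so column j has no entry above the diagonal.\<close>
        moreover from this have "i \<noteq> \<pi> j" using inj[of i j] min[of i] by auto
        ultimately show ?thesis using u' by (auto simp: lookup_det_monom)
      qed
    qed
    moreover have "lookup (det_monom n \<pi> S) (j, j, 0) < lookup (f_lead n ?k) (j, j, 0)"
      using j k by (auto simp: lookup_det_monom)
    ultimately show ?thesis by blast
  next
    case False
    then have sub: "{..<?k} \<subseteq> S" and fix_k: "\<And>j. j < ?k \<Longrightarrow> \<pi> j = j" by auto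
    have "finite S"
      using S by (rule finite_subset) simp
    then have S_eq: "S = {..<?k}"
      using card_subset_eq[OF _ sub] by simp
    then have "\<exists>j. \<pi> j \<noteq> j"
      using neq by auto
    then obtain j where j: "\<pi> j \<noteq> j" and min: "\<And>l. l < j \<Longrightarrow> \<pi> l = l"
      using exists_least_iff[of "\<lambda>j. \<pi> j \<noteq> j"] by auto
    \<comment> \<open>The columns below |S| are fixed by \<pi>, so j lies among those taken from
      Y.\<close>
    have jn: "j < n" "\<not> j < ?k"
      using j \<pi> fix_k by (auto simp: permutes_def)
    have jS: "l \<in> S \<longleftrightarrow> l < ?k" for l
      using S_eq by auto
    have "lookup (det_monom n \<pi> S) u = lookup (f_lead n ?k) u" if u: "tvar_greater u (j, j, 1)" for u
    proof -
      obtain i l c where u': "u = (i, l, c)" by (cases u)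
      consider "c = 0" | "c = 1" "l < j" | "c = 1" "l = j" "i < j"
        using u u' by (auto simp: tvar_greater_def)
      then show ?thesis
      proof cases
        case 1
        then show ?thesis using u' fix_k[of l] jS by (auto simp: lookup_det_monom)
      next
        case 2
        then show ?thesis using u' min[of l] jS by (auto simp: lookup_det_monom)
      next
        case 3
        then have "i \<noteq> \<pi> j" using inj[of i j] min[of i] by auto
        then show ?thesis using 3 u' by (auto simp: lookup_det_monom)
      qed
    qed
    moreover have "lookup (det_monom n \<pi> S) (j, j, 1) < lookup (f_lead n ?k) (j, j, 1)"
      using j jn by (auto simp: lookup_det_monom)
    ultimately show ?thesis by blast
  qed
  then show ?thesis
    by (simp add: deglex_less_def mdeg_det_monom)
qed

text \<open>The identity with the first k columns contributes coefficient 1, and every other pair a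
  strictly smaller monomial, so the leading term survives in every characteristic.\<close>

lemma is_lead_f_inv:
  assumes "k \<le> n"
  shows "is_lead (f_inv n k (n - k) :: (tvar, 'k::field) mpoly) (f_lead n k)"
proof -
  let ?I = "{\<pi>. \<pi> permutes {0..<n}} \<times> {S. S \<subseteq> {..<n} \<and> card S = k}"
  let ?g = "\<lambda>(\<pi>, S). single (det_monom n \<pi> S) (signof \<pi>) :: (tvar, 'k) mpoly"
  have "finite {S. S \<subseteq> {..<n} \<and> card S = k}"
    by (rule finite_subset[of _ "Pow {..<n}"]) auto
  then have fin: "finite ?I"
    by (simp add: finite_permutations)
  have mem: "(id, {..<k}) \<in> ?I"
    using assms by (auto simp: permutes_id)
  have "f_inv n k (n - k) = sum ?g ?I"
    unfolding f_inv_eq[OF assms] by (rule sum.cartesian_product)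
  also have "\<dots> = single (f_lead n k) 1 + sum ?g (?I - {(id, {..<k})})"
    using sum.remove[OF fin mem, of ?g] by simp
  also have "is_lead \<dots> (f_lead n k)"
  proof -
    have "all_below (f_lead n k) (?g x)" if x: "x \<in> ?I - {(id, {..<k})}" for x
    proof -
      obtain \<pi> S where [simp]: "x = (\<pi>, S)" by (cases x)
      have "deglex_less (det_monom n \<pi> S) (f_lead n k)"
        using x det_monom_less_f_lead[of \<pi> n S] by auto
      then show ?thesis by (auto simp: all_below_def split: if_splits)
    qed
    then have "all_below (f_lead n k) (sum ?g (?I - {(id, {..<k})}))"
      by (rule all_below_sum)
    then show ?thesis
      unfolding is_lead_def using zero_neq_one[where 'a = 'k] by metis
  qed
  finally show ?thesis .
qed

text \<open>Exponent vector of the leading monomial of the power product of the f's with exponents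
  a.\<close>

definition lead_exponent :: "nat \<Rightarrow> (nat \<Rightarrow>\<^sub>0 nat) \<Rightarrow> tvar \<Rightarrow>\<^sub>0 nat" where
  "lead_exponent n a = (\<Sum>k\<in>keys a. \<Sum>i<lookup a k. f_lead n k)"

lemma lookup_lead_exponent:
  assumes "keys a \<subseteq> {..n}"
  shows "lookup (lead_exponent n a) v = (\<Sum>k\<le>n. lookup a k * lookup (f_lead n k) v)"
proof -
  have "lookup (lead_exponent n a) v = (\<Sum>k\<in>keys a. lookup a k * lookup (f_lead n k) v)"
    by (simp add: lead_exponent_def lookup_sum)
  also have "\<dots> = (\<Sum>k\<le>n. lookup a k * lookup (f_lead n k) v)"
    using assms by (intro sum.mono_neutral_left) (auto simp: in_keys_iff)
  finally show ?thesis .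
qed

text \<open>The variable (i, i, 1) divides the leading monomial of f_(k,n-k) exactly when k \<le> i,
  so its exponent is the partial sum a 0 + ... + a i; successive differences give a 0, ..., a (n -
  1). The variable (n - 1, n - 1, 0) occurs only for k = n and gives a n.\<close>

lemma inj_on_lead_exponent:
  assumes n: "n \<ge> 1"
  shows "inj_on (lead_exponent n) {a. keys a \<subseteq> {..n}}"
proof (rule inj_onI)
  fix a b assume ab: "a \<in> {a. keys a \<subseteq> {..n}}" "b \<in> {a. keys a \<subseteq> {..n}}"
    and eq: "lead_exponent n a = lead_exponent n b"
  have top: "lookup (lead_exponent n a) (n - 1, n - 1, 0) = lookup a n" if "keys a \<subseteq> {..n}" for a
  proof -
    have "lookup (lead_exponent n a) (n - 1, n - 1, 0) = (\<Sum>k\<le>n. if k = n then lookup a n else 0)"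
      unfolding lookup_lead_exponent[OF that] using n
      by (intro sum.cong refl) (auto simp: lookup_det_monom)
    then show ?thesis by simp
  qed
  have partial: "lookup (lead_exponent n a) (i, i, 1) = (\<Sum>k\<le>i. lookup a k)"
    if "keys a \<subseteq> {..n}" "i < n" for a i
  proof -
    have "lookup (lead_exponent n a) (i, i, 1) = (\<Sum>k\<le>n. if k \<le> i then lookup a k else 0)"
      unfolding lookup_lead_exponent[OF that(1)] using that(2)
      by (intro sum.cong refl) (auto simp: lookup_det_monom)
    also have "\<dots> = (\<Sum>k\<le>i. lookup a k)"
      using that(2) by (intro sum.mono_neutral_cong_right) auto
    finally show ?thesis .
  qed
  have sums: "(\<Sum>k\<le>i. lookup a k) = (\<Sum>k\<le>i. lookup b k)" if "i < n" for i
    using partial[of a i] partial[of b i] ab eq that by auto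
  show "a = b"
  proof (rule poly_mapping_eqI)
    fix k
    consider "k < n" | "k = n" | "k > n" by linarith
    then show "lookup a k = lookup b k"
    proof cases
      case 1
      show ?thesis
      proof (cases k)
        case 0
        then show ?thesis using sums[of 0] 1 by simp
      next
        case (Suc l)
        then show ?thesis using sums[of l] sums[of k] 1 by simp
      qed
    next
      case 2
      then show ?thesis using top[of a] top[of b] ab eq by auto
    next
      case 3
      then have "k \<notin> keys a" "k \<notin> keys b" using ab by auto
      then show ?thesis by (simp add: in_keys_iff)
    qed
  qed
qed

lemma single_sum_one: "single (\<Sum>i\<in>I. m i) (1 :: 'k::field) = (\<Prod>i\<in>I. single (m i) 1)"
proof (induction I rule: infinite_finite_induct)
  case (insert i I)
  then show ?case
    using mult_single[of "m i" "1 :: 'k" "sum m I" 1] by simp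
qed simp_all

text \<open>The terms of the restriction h correspond to power products of the f's with pairwise
  distinct leading exponents, so a single one of them supplies the leading monomial of p.\<close>

lemma lm_in_algebra_gen:
  fixes p :: "(tvar, 'k::field) mpoly"
  assumes inf: "infinite (UNIV :: 'k set)" and n: "n \<ge> 1"
    and p: "p \<in> invariant_ring n" and "p \<noteq> 0"
  shows "lm p \<in> algebra_gen (lm ` {f_inv n k (n - k) | k. k \<le> n})"
proof -
  let ?h = "section_restrict n p" and ?f = "\<lambda>k. f_inv n k (n - k) :: (tvar, 'k) mpoly"
  let ?g = "\<lambda>a. Const (lookup ?h a) * monom_val ?f a"
  have p_eq: "p = (\<Sum>a\<in>keys ?h. ?g a)"
    using invariant_eq_f_subst[OF inf n p] by (simp add: f_subst_def insertion_def)
  have keys: "keys a \<subseteq> {..n}" if "a \<in> keys ?h" for a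
    using that p section_restrict_in_poly_ring[of p n] by (auto simp: poly_ring_def invariant_ring_def)
  have lead: "is_lead (?g a) (lead_exponent n a)" if a: "a \<in> keys ?h" for a
  proof -
    have "is_lead (monom_val ?f a) (lead_exponent n a)"
      unfolding monom_val_def lead_exponent_def using keys[OF a]
      by (intro is_lead_prod is_lead_power is_lead_f_inv) auto
    then show ?thesis
      using is_lead_mult[OF is_lead_Const[of "lookup ?h a"]] a by (fastforce simp: in_keys_iff)
  qed
  have "keys ?h \<noteq> {}"
    using p_eq \<open>p \<noteq> 0\<close> by auto
  then obtain a where a: "a \<in> keys ?h" "is_lead p (lead_exponent n a)"
    using is_lead_sum[of "keys ?h" "lead_exponent n" ?g] lead keys p_eq
      inj_on_subset[OF inj_on_lead_exponent[OF n], of "keys ?h"] by auto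
  have "lm p = (\<Prod>k\<in>keys a. single (f_lead n k) 1 ^ lookup a k)"
    unfolding lm_eq[OF a(2)] lead_exponent_def single_sum_one by simp
  also have "\<dots> = monom_val (\<lambda>k. lm (?f k)) a"
    unfolding monom_val_def using keys[OF a(1)]
    by (intro prod.cong refl) (auto simp: lm_eq[OF is_lead_f_inv])
  also have "\<dots> \<in> algebra_gen (lm ` {?f k | k. k \<le> n})"
  proof (rule subalgebra_monom_val[OF is_subalgebra_algebra_gen])
    fix k assume "k \<in> keys a"
    then have "k \<le> n" using keys[OF a(1)] by auto
    then show "lm (?f k) \<in> algebra_gen (lm ` {?f k | k. k \<le> n})"
      by (intro subsetD[OF algebra_gen_superset]) auto
  qed
  finally show ?thesis .
qed

theorem theorem3p8:
  fixes n :: nat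
  assumes "infinite (UNIV :: 'k::field set)"
    and "n \<ge> 1"
  shows "sagbi_basis (invariant_ring n :: (tvar, 'k) mpoly set) {f_inv n k (n - k) | k. k \<le> n}
    \<and> (invariant_ring n :: (tvar, 'k) mpoly set) = algebra_gen {f_inv n k (n - k) | k. k \<le> n}
    \<and> algebra_isomorphic (invariant_ring n :: (tvar, 'k) mpoly set)
        (poly_ring {..<n + 1} :: (nat, 'k) mpoly set)"
proof (intro conjI)
  let ?A = "invariant_ring n :: (tvar, 'k) mpoly set"
  let ?F = "{f_inv n k (n - k) | k. k \<le> n} :: (tvar, 'k) mpoly set"
  have F: "?F \<subseteq> ?A - {0}"
    using f_inv_in_invariant_ring[OF assms(1)] is_lead_nonzero[OF is_lead_f_inv] by auto
  then have "lm ` ?F \<subseteq> {lm p | p. p \<in> ?A \<and> p \<noteq> 0}" by auto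
  then have "algebra_gen (lm ` ?F) \<subseteq> algebra_gen {lm p | p. p \<in> ?A \<and> p \<noteq> 0}"
    unfolding algebra_gen_def by (rule hull_mono)
  moreover have "algebra_gen {lm p | p. p \<in> ?A \<and> p \<noteq> 0} \<subseteq> algebra_gen (lm ` ?F)"
    using lm_in_algebra_gen[OF assms]
    by (intro algebra_gen_minimal is_subalgebra_algebra_gen) auto
  ultimately show "sagbi_basis ?A ?F"
    unfolding sagbi_basis_def using F is_subalgebra_invariant_ring by auto
  show "?A = algebra_gen ?F"
    by (rule invariant_ring_eq_algebra_gen[OF assms])
  show "algebra_isomorphic ?A (poly_ring {..<n + 1} :: (nat, 'k) mpoly set)"
    by (rule invariant_ring_isomorphic[OF assms])
qed

end
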